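(* Let $E$ be a separable complex Hilbert space. Fix angles $\theta_1,\theta_2\in[0,2\pi)$ and covariances $\sigma_1,\sigma_2>0$. Let $\mathcal{M}_1$ and $\mathcal{M}_2$ be nonzero closed subspaces of $H^2_E(\mathbb{T})\oplus E$ that are invariant under the Brownian shifts $B^E_{\sigma_1,e^{i\theta_1}}$ and $B^E_{\sigma_2,e^{i\theta_2}}$, respectively. Then \[ B^E_{\sigma_1,e^{i\theta_1}}\big|_{\mathcal{M}_1}\cong B^E_{\sigma_2,e^{i\theta_2}}\big|_{\mathcal{M}_2} \] if and only if any one of the following conditions is true: (1) Both $\mathcal{M}_1$ and $\mathcal{M}_2$ are Type I, and if $\mathcal{M}_i=\Phi_iH^2_{E_i}(\mathbb{T})\oplus\{0\}$ is the canonical representation of $\mathcal{M}_i$ for $i=1,2$, then $\dim E_1=\dim E_2$. (2) Both $\mathcal{M}_1$ and $\mathcal{M}_2$ are Type II. Furthermore, $\theta_1=\theta_2$, and if $\mathcal{M}_j=\langle\mathcal{G}_j\rangle\oplus(\Phi_jH^2_{E_j}(\mathbb{T})\oplus\{0\})$ is the canonical representation of $\mathcal{M}_j$, $j=1,2$, then there exist a pair of unitaries $U_{\mathcal{G}}:\langle\mathcal{G}_1\rangle\to\langle\mathcal{G}_2\rangle$ and $U_E:E_1\to E_2$ such that \[ U_Ex_1'=x_2'\quad\text{whenever}\quad U_{\mathcal{G}}\begin{bmatrix}g_1\\ y_1\end{bmatrix}=\begin{bmatrix}g_2\\ y_2\end{bmatrix}, \] where $\begin{bmatrix}g_j\\ y_j\end{bmatrix}\in\langle\mathcal{G}_j\rangle$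 with \[ g_j=\frac{\Phi_jx_j'-\sigma_jy_j}{z-e^{i\theta_j}} \] for some unique $x_j'\in E_j$, $j=1,2$.
   Context: $\mathbb{D}=\{z\in\mathbb{C}:|z|<1\}$ and $\mathbb{T}=\partial\mathbb{D}$. For a complex Hilbert space $E$, $H^2_E(\mathbb{T})$ is the $E$-valued Hardy space, i.e. the closed subspace of $L^2_E(\mathbb{T})$ of functions whose Fourier coefficients of negative index vanish (equivalently, square-summable $E$-valued power series on $\mathbb{D}$), and $S_E$ is the shift $S_Ef=zf$ on it. Elements of $E$ are identified with constant functions; $i_E:E\to H^2_E(\mathbb{T})$ is the inclusion $(i_Ex)(z)=x$. The Brownian shift on $H^2_E(\mathbb{T})\oplus E$ of covariance $\sigma>0$ and angle $\theta\in[0,2\pi)$ is the bounded operator \[ B^E_{\sigma,e^{i\theta}}=\begin{bmatrix}S_E&\sigma i_E\\ 0&e^{i\theta}I_E\end{bmatrix},\qquad B^E_{\sigma,e^{i\theta}}\begin{bmatrix}f\\ x\end{bmatrix}=\begin{bmatrix}zf+\sigma x\\ e^{i\theta}x\end{bmatrix}. \] For Hilbert spaces $E_*,E$, $H^\infty_{\mathcal{B}(E_*,E)}(\mathbb{T})$ is the Banach space of bounded analytic functions on $\mathbb{D}$ with values in $\mathcal{B}(E_*,E)$ (bounded operators from $E_*$ to $E$). Each such $\Phi$ induces the multiplication operator $M_\Phi:H^2_{E_*}(\mathbb{T})\to H^2_E(\mathbb{T})$, $M_\Phi f=\Phi f$; $\Phi$ is called inner if $M_\Phi$ is an isometry (equivalently,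 $\Phi(z)$ is an isometry for almost every $z\in\mathbb{T}$). $\Phi H^2_{E_*}(\mathbb{T})$ denotes the range of $M_\Phi$. $\langle\mathcal{N}\rangle$ denotes the closed linear span of a set $\mathcal{N}$; a subset is nonzero if it contains a nonzero element; $\oplus$ between subspaces of $H^2_E(\mathbb{T})\oplus E$ denotes an orthogonal direct sum. A closed $B^E_{\sigma,e^{i\theta}}$-invariant subspace $\mathcal{M}$ of $H^2_E(\mathbb{T})\oplus E$ is Type I if $\mathcal{M}\subseteq H^2_E(\mathbb{T})\oplus\{0\}$, and Type II if $\mathcal{M}\nsubseteq H^2_E(\mathbb{T})\oplus\{0\}$. Canonical representations. A nonzero Type I invariant subspace of $B^E_{\sigma,e^{i\theta}}$ can be written as $\mathcal{M}=\Phi H^2_{E_1}(\mathbb{T})\oplus\{0\}$ with $E_1$ a nonzero Hilbert space and $\Phi\in H^\infty_{\mathcal{B}(E_1,E)}(\mathbb{T})$ inner. A Type II invariant subspace of $B^E_{\sigma,e^{i\theta}}$ can be written as $\mathcal{M}=\langle\mathcal{G}\rangle\oplus(\Phi H^2_{E_2}(\mathbb{T})\oplus\{0\})$ with $E_2$ a nonzero Hilbert space, $\Phi\in H^\infty_{\mathcal{B}(E_2,E)}(\mathbb{T})$ inner, and $\mathcal{G}$ a nonzero subset of \[ \mathcal{G}_\Phi=\left\{\begin{bmatrix}g\\ y\end{bmatrix}\in H^2_E(\mathbb{T})\oplus E:\ y\in E,\ g=\frac{\Phi x-\sigma y}{z-e^{i\theta}}\in H^2_E(\mathbb{T})\text{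 for some }x\in E_2\right\}, \] which is a closed subspace of $H^2_E(\mathbb{T})\oplus E$. These are called the canonical representations of Type I and Type II invariant subspaces (for $\mathcal{M}_j$, with $\sigma=\sigma_j$ and $\theta=\theta_j$). $A\cong B$ means unitary equivalence: for $A$ on $\mathcal{H}_1$ and $B$ on $\mathcal{H}_2$ there is a unitary (surjective linear isometry) $U:\mathcal{H}_1\to\mathcal{H}_2$ with $UA=BU$. $\dim$ denotes Hilbert space dimension. *)

theory Defs
  imports "HOL-Analysis.Analysis"
begin

unbundle cardinal_syntax

section \<open>Complex Hilbert spaces\<close>

text \<open>The inner product is linear in the first and conjugate-linear in the second argument. The
  real structure of the underlying Banach space is the restriction of the complex one.\<close>

class complex_hilbert = banach +
  fixes scaleC :: "complex \<Rightarrow> 'a \<Rightarrow> 'a" (infixr \<open>*\<^sub>C\<close> 75)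
    and cinner :: "'a \<Rightarrow> 'a \<Rightarrow> complex"
  assumes scaleR_scaleC: "r *\<^sub>R x = complex_of_real r *\<^sub>C x"
    and scaleC_add_right: "a *\<^sub>C (x + y) = a *\<^sub>C x + a *\<^sub>C y"
    and scaleC_add_left: "(a + b) *\<^sub>C x = a *\<^sub>C x + b *\<^sub>C x"
    and scaleC_scaleC: "a *\<^sub>C (b *\<^sub>C x) = (a * b) *\<^sub>C x"
    and cinner_commute: "cinner x y = cnj (cinner y x)"
    and cinner_add_left: "cinner (x + y) z = cinner x z + cinner y z"
    and cinner_scaleC_left: "cinner (a *\<^sub>C x) y = a * cinner x y"
    and cinner_self: "cinner x x = complex_of_real ((norm x)\<^sup>2)"

lemma scaleC_one [simp]: "1 *\<^sub>C x = (x::'a::complex_hilbert)"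
  using scaleR_scaleC[of 1 x] by simp

global_interpretation complex_vector: vector_space "scaleC :: complex \<Rightarrow> 'a \<Rightarrow> 'a::complex_hilbert"
  defines csubspace_def: csubspace = complex_vector.subspace
    and cspan_def: cspan = complex_vector.span
  by unfold_locales (simp_all add: scaleC_add_right scaleC_add_left scaleC_scaleC)

lemma cinner_add_right:
  "cinner x (y + z) = cinner x y + cinner (x::'a::complex_hilbert) z"
  by (metis cinner_add_left cinner_commute complex_cnj_add)

lemma cinner_scaleC_right: "cinner x (a *\<^sub>C y) = cnj a * cinner (x::'a::complex_hilbert) y"
  by (metis cinner_commute cinner_scaleC_left complex_cnj_mult)

lemma norm_scaleC [simp]: "norm (a *\<^sub>C x) = cmod a * norm (x::'a::complex_hilbert)"
proof -
  have "complex_of_real ((norm (a *\<^sub>C x))\<^sup>2) = (a * cnj a) * complex_of_real ((norm x)\<^sup>2)"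
    by (simp only: cinner_self [symmetric] cinner_scaleC_left cinner_scaleC_right mult.assoc mult.left_commute)
  also have "\<dots> = complex_of_real ((cmod a * norm x)\<^sup>2)"
    by (simp add: complex_norm_square [symmetric] power_mult_distrib)
  finally have "(norm (a *\<^sub>C x))\<^sup>2 = (cmod a * norm x)\<^sup>2"
    by (simp only: of_real_eq_iff)
  then show ?thesis
    by (rule power2_eq_imp_eq) auto
qed

lemma Re_cinner_le: "2 * Re (cinner x y) \<le> (norm x)\<^sup>2 + (norm (y::'a::complex_hilbert))\<^sup>2"
proof -
  have m: "x - y = x + (- 1) *\<^sub>C y"
    using scaleR_scaleC[of "-1" y] by simp
  have r: "Re (cinner y x) = Re (cinner x y)"
    by (subst cinner_commute) simp
  have "Re (cinner (x - y) (x - y)) = (norm x)\<^sup>2 + (norm y)\<^sup>2 - 2 * Re (cinner x y)"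
    unfolding m cinner_add_left cinner_add_right cinner_scaleC_left cinner_scaleC_right
    using r by (simp add: cinner_self del: of_real_power)
  moreover have "Re (cinner (x - y) (x - y)) = (norm (x - y))\<^sup>2"
    unfolding cinner_self by simp
  ultimately show ?thesis
    by (smt (verit) zero_le_power2)
qed

lemma cmod_cinner_le: "cmod (cinner x y) \<le> (norm x)\<^sup>2 + (norm (y::'a::complex_hilbert))\<^sup>2"
proof -
  have "2 * Re (c * cinner x y) \<le> (norm x)\<^sup>2 + (norm y)\<^sup>2" if "cmod c = 1" for c
    using Re_cinner_le[of "c *\<^sub>C x" y] that by (simp add: cinner_scaleC_left)
  from this[of 1] this[of "-1"] this[of \<i>] this[of "-\<i>"]
  have "\<bar>Re (cinner x y)\<bar> + \<bar>Im (cinner x y)\<bar> \<le> (norm x)\<^sup>2 + (norm y)\<^sup>2"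
    by simp
  with cmod_le[of "cinner x y"] show ?thesis by linarith
qed

instantiation complex :: complex_hilbert
begin
definition "scaleC_complex (a::complex) (x::complex) = a * x"
definition "cinner_complex (x::complex) (y::complex) = x * cnj y"
instance
proof
  show "cinner x x = complex_of_real ((norm x)\<^sup>2)" for x :: complex
    unfolding cinner_complex_def by (rule complex_norm_square [symmetric])
qed (simp_all add: scaleC_complex_def cinner_complex_def scaleR_conv_of_real algebra_simps)
end

text \<open>The norm of the product type is the Hilbert space direct sum norm.\<close>

instantiation prod :: (complex_hilbert, complex_hilbert) complex_hilbert
begin
definition "scaleC_prod (a::complex) (x :: 'a \<times> 'b) = (a *\<^sub>C fst x, a *\<^sub>C snd x)"
definition "cinner_prod (x :: 'a \<times> 'b) y = cinner (fst x) (fst y) + cinner (snd x) (snd y)"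
instance
proof
  show "cinner x y = cnj (cinner y x)" for x y :: "'a \<times> 'b"
    unfolding cinner_prod_def by (metis cinner_commute complex_cnj_add)
  show "cinner x x = complex_of_real ((norm x)\<^sup>2)" for x :: "'a \<times> 'b"
    by (simp add: cinner_prod_def cinner_self norm_prod_def)
qed (simp_all add: scaleC_prod_def cinner_prod_def prod_eq_iff scaleR_scaleC scaleC_add_right
    scaleC_add_left scaleC_scaleC cinner_add_left cinner_scaleC_left algebra_simps)
end

definition clinear_on :: "'a::complex_hilbert set \<Rightarrow> ('a \<Rightarrow> 'b::complex_hilbert) \<Rightarrow> bool" where
  "clinear_on S U \<longleftrightarrow>
     (\<forall>x\<in>S. \<forall>y\<in>S. U (x + y) = U x + U y) \<and> (\<forall>c. \<forall>x\<in>S. U (c *\<^sub>C x) = c *\<^sub>C U x)"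

text \<open>Unitaries between closed subspaces; values of the map outside the domain are irrelevant.\<close>

definition unitary_between ::
  "'a::complex_hilbert set \<Rightarrow> 'b::complex_hilbert set \<Rightarrow> ('a \<Rightarrow> 'b) \<Rightarrow> bool" where
  "unitary_between S T U \<longleftrightarrow> clinear_on S U \<and> (\<forall>x\<in>S. norm (U x) = norm x) \<and> U ` S = T"

text \<open>Unitary equivalence of the restrictions of \<open>A\<close> to \<open>S\<close> and of \<open>B\<close> to \<open>T\<close>.\<close>

definition unitarily_equivalent_on ::
  "'a::complex_hilbert set \<Rightarrow> ('a \<Rightarrow> 'a) \<Rightarrow> 'b::complex_hilbert set \<Rightarrow> ('b \<Rightarrow> 'b) \<Rightarrow> bool" where
  "unitarily_equivalent_on S A T B \<longleftrightarrow>
     (\<exists>U. unitary_between S T U \<and> (\<forall>x\<in>S. U (A x) = B (U x)))"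

definition closed_cspan :: "'a::complex_hilbert set \<Rightarrow> 'a set" where
  "closed_cspan N = closure (cspan N)"

definition orthonormal_basis :: "'a::complex_hilbert set \<Rightarrow> bool" where
  "orthonormal_basis A \<longleftrightarrow>
     (\<forall>x\<in>A. norm x = 1) \<and> (\<forall>x\<in>A. \<forall>y\<in>A. x \<noteq> y \<longrightarrow> cinner x y = 0) \<and> closed_cspan A = UNIV"

text \<open>Hilbert space dimension, as a cardinal number: the cardinality of an orthonormal basis.
  Dimensions are compared with \<open>=o\<close>.\<close>

definition hilbert_dim :: "'a::complex_hilbert itself \<Rightarrow> 'a rel" where
  "hilbert_dim _ = |SOME A :: 'a set. orthonormal_basis A|"

definition invariant_subspace :: "('a::complex_hilbert \<Rightarrow> 'a) \<Rightarrow> 'a set \<Rightarrow> bool" where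
  "invariant_subspace T M \<longleftrightarrow> csubspace M \<and> closed M \<and> T ` M \<subseteq> M"

definition is_orthogonal_sum :: "'a::complex_hilbert set \<Rightarrow> 'a set \<Rightarrow> 'a set \<Rightarrow> bool" where
  "is_orthogonal_sum M A B \<longleftrightarrow>
     (\<forall>a\<in>A. \<forall>b\<in>B. cinner a b = 0) \<and> M = {a + b | a b. a \<in> A \<and> b \<in> B}"


section \<open>The vector-valued Hardy space\<close>

text \<open>An element of $H^2_E$ is represented by its sequence of Fourier (Taylor) coefficients.\<close>

typedef (overloaded) ('a::complex_hilbert) hardy =
  "{a :: nat \<Rightarrow> 'a. summable (\<lambda>n. (norm (a n))\<^sup>2)}"
  morphisms hcoeff Abs_hardy
  by (rule exI[of _ "\<lambda>_. 0"]) simp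

setup_lifting type_definition_hardy

lemma summable_hcoeff: "summable (\<lambda>n. (norm (hcoeff f n))\<^sup>2)"
  using hcoeff[of f] by simp

lemma hardy_eqI: "(\<And>n. hcoeff f n = hcoeff g n) \<Longrightarrow> f = g"
  by (simp add: hcoeff_inject [symmetric] fun_eq_iff)

lemma square_summable_add:
  fixes a b :: "nat \<Rightarrow> 'a::complex_hilbert"
  assumes "summable (\<lambda>n. (norm (a n))\<^sup>2)" "summable (\<lambda>n. (norm (b n))\<^sup>2)"
  shows "summable (\<lambda>n. (norm (a n + b n))\<^sup>2)"
proof (rule summable_comparison_test')
  show "summable (\<lambda>n. 2 * (norm (a n))\<^sup>2 + 2 * (norm (b n))\<^sup>2)"
    using assms by (intro summable_add summable_mult)
  show "norm ((norm (a n + b n))\<^sup>2) \<le> 2 * (norm (a n))\<^sup>2 + 2 * (norm (b n))\<^sup>2" for n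
  proof -
    have "(norm (a n + b n))\<^sup>2 \<le> (norm (a n) + norm (b n))\<^sup>2"
      by (intro power_mono norm_triangle_ineq) auto
    also have "\<dots> \<le> 2 * (norm (a n))\<^sup>2 + 2 * (norm (b n))\<^sup>2"
      using zero_le_power2[of "norm (a n) - norm (b n)"]
      by (simp add: power2_eq_square algebra_simps)
    finally show ?thesis by simp
  qed
qed

lemma square_summable_scaleC:
  fixes a :: "nat \<Rightarrow> 'a::complex_hilbert"
  shows "summable (\<lambda>n. (norm (a n))\<^sup>2) \<Longrightarrow> summable (\<lambda>n. (norm (c *\<^sub>C a n))\<^sup>2)"
  by (simp add: power_mult_distrib summable_mult)

instantiation hardy :: (complex_hilbert) real_normed_vector
begin

lift_definition zero_hardy :: "'a hardy" is "\<lambda>_. 0" by simp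
lift_definition plus_hardy :: "'a hardy \<Rightarrow> 'a hardy \<Rightarrow> 'a hardy" is "\<lambda>a b n. a n + b n"
  by (rule square_summable_add)
lift_definition uminus_hardy :: "'a hardy \<Rightarrow> 'a hardy" is "\<lambda>a n. - a n" by simp
lift_definition minus_hardy :: "'a hardy \<Rightarrow> 'a hardy \<Rightarrow> 'a hardy" is "\<lambda>a b n. a n - b n"
  using square_summable_add[where b = "\<lambda>n. - b n" for b] by simp
lift_definition scaleR_hardy :: "real \<Rightarrow> 'a hardy \<Rightarrow> 'a hardy" is "\<lambda>r a n. r *\<^sub>R a n"
  by (simp add: power_mult_distrib summable_mult)

definition norm_hardy :: "'a hardy \<Rightarrow> real" where
  "norm_hardy f = sqrt (\<Sum>n. (norm (hcoeff f n))\<^sup>2)"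
definition sgn_hardy :: "'a hardy \<Rightarrow> 'a hardy" where
  "sgn_hardy f = scaleR (inverse (norm f)) f"
definition dist_hardy :: "'a hardy \<Rightarrow> 'a hardy \<Rightarrow> real" where
  "dist_hardy f g = norm (f - g)"
definition uniformity_hardy :: "('a hardy \<times> 'a hardy) filter" where
  "uniformity_hardy = (INF e\<in>{0 <..}. principal {(x, y). dist x y < e})"
definition open_hardy :: "'a hardy set \<Rightarrow> bool" where
  "open_hardy S = (\<forall>x\<in>S. \<forall>\<^sub>F (x', y) in uniformity. x' = x \<longrightarrow> y \<in> S)"

lemma L2_set_hcoeff_le: "L2_set (\<lambda>n. norm (hcoeff f n)) {..<N} \<le> norm f"
  unfolding L2_set_def norm_hardy_def
  by (intro real_sqrt_le_mono sum_le_suminf summable_hcoeff) auto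

lemma norm_hardy_leI:
  assumes "\<And>N. L2_set (\<lambda>n. norm (hcoeff f n)) {..<N} \<le> C"
  shows "norm f \<le> C"
proof -
  have C: "0 \<le> C" using assms[of 0] by simp
  have "(\<Sum>n. (norm (hcoeff f n))\<^sup>2) \<le> C\<^sup>2"
  proof (rule suminf_le_const[OF summable_hcoeff])
    fix N
    have "L2_set (\<lambda>n. norm (hcoeff f n)) {..<N} \<le> C" by (rule assms)
    then show "(\<Sum>n<N. (norm (hcoeff f n))\<^sup>2) \<le> C\<^sup>2"
      unfolding L2_set_def by (rule sqrt_le_D)
  qed
  then show ?thesis unfolding norm_hardy_def using C by (simp add: real_le_lsqrt suminf_nonneg summable_hcoeff)
qed

instance
proof
  fix f g h :: "'a hardy" and r s :: real
  show "f + g + h = f + (g + h)" "f + g = g + f" "0 + f = f" "- f + f = 0" "f - g = f + - g"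
    "r *\<^sub>R (f + g) = r *\<^sub>R f + r *\<^sub>R g" "(r + s) *\<^sub>R f = r *\<^sub>R f + s *\<^sub>R f"
    "r *\<^sub>R s *\<^sub>R f = (r * s) *\<^sub>R f" "1 *\<^sub>R f = f"
    by (transfer; simp add: fun_eq_iff algebra_simps)+
  show "sgn f = inverse (norm f) *\<^sub>R f" by (simp add: sgn_hardy_def)
  show "dist f g = norm (f - g)" by (simp add: dist_hardy_def)
  show "uniformity = (INF e\<in>{0 <..}. principal {(x :: 'a hardy, y). dist x y < e})"
    by (simp add: uniformity_hardy_def)
  show "open U = (\<forall>x\<in>U. \<forall>\<^sub>F (x', y) in uniformity. x' = x \<longrightarrow> y \<in> U)" for U :: "'a hardy set"
    by (simp add: open_hardy_def)
  show "norm f = 0 \<longleftrightarrow> f = 0"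
    unfolding norm_hardy_def real_sqrt_eq_zero_cancel_iff
    by (subst suminf_eq_zero_iff[OF summable_hcoeff])
      (auto simp: zero_hardy.rep_eq intro: hardy_eqI)
  show "norm (f + g) \<le> norm f + norm g"
  proof (rule norm_hardy_leI)
    fix N
    have "L2_set (\<lambda>n. norm (hcoeff (f + g) n)) {..<N}
        \<le> L2_set (\<lambda>n. norm (hcoeff f n) + norm (hcoeff g n)) {..<N}"
      by (intro L2_set_mono) (auto simp: plus_hardy.rep_eq norm_triangle_ineq)
    also have "\<dots> \<le> L2_set (\<lambda>n. norm (hcoeff f n)) {..<N} + L2_set (\<lambda>n. norm (hcoeff g n)) {..<N}"
      by (rule L2_set_triangle_ineq)
    also have "\<dots> \<le> norm f + norm g" by (intro add_mono L2_set_hcoeff_le)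
    finally show "L2_set (\<lambda>n. norm (hcoeff (f + g) n)) {..<N} \<le> norm f + norm g" .
  qed
  show "norm (r *\<^sub>R f) = \<bar>r\<bar> * norm f"
    unfolding norm_hardy_def
    by (simp add: scaleR_hardy.rep_eq power_mult_distrib suminf_mult[OF summable_hcoeff] real_sqrt_mult)
qed

end

instantiation hardy :: (complex_hilbert) complex_hilbert
begin

lift_definition scaleC_hardy :: "complex \<Rightarrow> 'a hardy \<Rightarrow> 'a hardy" is "\<lambda>c a n. c *\<^sub>C a n"
  by (rule square_summable_scaleC)

definition cinner_hardy :: "'a hardy \<Rightarrow> 'a hardy \<Rightarrow> complex" where
  "cinner_hardy f g = (\<Sum>n. cinner (hcoeff f n) (hcoeff g n))"

lemma summable_cinner_hcoeff: "summable (\<lambda>n. cinner (hcoeff f n) (hcoeff g n))"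
  by (rule summable_comparison_test'[OF summable_add[OF summable_hcoeff[of f] summable_hcoeff[of g]]])
    (rule cmod_cinner_le)

lemma norm_hcoeff_le: "norm (hcoeff f n) \<le> norm f"
  using member_le_L2_set[of "{..<Suc n}" n "\<lambda>n. norm (hcoeff f n)"] L2_set_hcoeff_le[of f "Suc n"]
  by simp

instance
proof
  fix f g h :: "'a hardy" and a b :: complex and r :: real
  show "r *\<^sub>R f = complex_of_real r *\<^sub>C f" "a *\<^sub>C (f + g) = a *\<^sub>C f + a *\<^sub>C g"
    "(a + b) *\<^sub>C f = a *\<^sub>C f + b *\<^sub>C f" "a *\<^sub>C b *\<^sub>C f = (a * b) *\<^sub>C f"
    by (transfer; simp add: fun_eq_iff scaleR_scaleC scaleC_add_right scaleC_add_left scaleC_scaleC)+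
  show "cinner f g = cnj (cinner g f)"
  proof -
    have "(\<lambda>n. cnj (cinner (hcoeff g n) (hcoeff f n))) sums cnj (cinner g f)"
      unfolding sums_cnj cinner_hardy_def by (rule summable_sums[OF summable_cinner_hcoeff])
    then show ?thesis
      unfolding cinner_commute[of "hcoeff f _", symmetric] cinner_hardy_def by (simp add: sums_iff)
  qed
  show "cinner (f + g) h = cinner f h + cinner g h"
    unfolding cinner_hardy_def plus_hardy.rep_eq cinner_add_left
    by (rule suminf_add[symmetric]; rule summable_cinner_hcoeff)
  show "cinner (a *\<^sub>C f) g = a * cinner f g"
    unfolding cinner_hardy_def scaleC_hardy.rep_eq cinner_scaleC_left
    by (rule suminf_mult; rule summable_cinner_hcoeff)
  show "cinner f f = complex_of_real ((norm f)\<^sup>2)"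
    unfolding cinner_hardy_def cinner_self norm_hardy_def
    by (simp add: suminf_nonneg summable_hcoeff suminf_of_real[symmetric] del: of_real_power)
next
  fix X :: "nat \<Rightarrow> 'a hardy"
  assume X: "Cauchy X"
  have "Cauchy (\<lambda>m. hcoeff (X m) n)" for n
  proof (rule metric_CauchyI)
    fix e :: real assume "e > 0"
    then obtain K where K: "\<And>m k. m \<ge> K \<Longrightarrow> k \<ge> K \<Longrightarrow> dist (X m) (X k) < e"
      using metric_CauchyD[OF X] by blast
    have "dist (hcoeff (X m) n) (hcoeff (X k) n) < e" if "m \<ge> K" "k \<ge> K" for m k
      using K[OF that] norm_hcoeff_le[of "X m - X k" n]
      by (simp add: dist_norm minus_hardy.rep_eq)
    then show "\<exists>K. \<forall>m\<ge>K. \<forall>k\<ge>K. dist (hcoeff (X m) n) (hcoeff (X k) n) < e" by blast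
  qed
  then have conv: "convergent (\<lambda>m. hcoeff (X m) n)" for n
    by (rule Cauchy_convergent)
  define a where "a n = lim (\<lambda>m. hcoeff (X m) n)" for n
  have a: "(\<lambda>m. hcoeff (X m) n) \<longlonglongrightarrow> a n" for n
    using conv[of n] unfolding a_def convergent_LIMSEQ_iff .
  have key: "\<exists>K. \<forall>m\<ge>K. \<forall>N. L2_set (\<lambda>n. norm (hcoeff (X m) n - a n)) {..<N} \<le> e"
    if "e > 0" for e
  proof -
    obtain K where K: "\<And>m k. m \<ge> K \<Longrightarrow> k \<ge> K \<Longrightarrow> dist (X m) (X k) < e"
      using metric_CauchyD[OF X \<open>e > 0\<close>] by blast
    have "L2_set (\<lambda>n. norm (hcoeff (X m) n - a n)) {..<N} \<le> e" if m: "m \<ge> K" for m N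
    proof (rule LIMSEQ_le_const2)
      show "(\<lambda>k. L2_set (\<lambda>n. norm (hcoeff (X m) n - hcoeff (X k) n)) {..<N})
          \<longlonglongrightarrow> L2_set (\<lambda>n. norm (hcoeff (X m) n - a n)) {..<N}"
        unfolding L2_set_def by (intro tendsto_intros a)
      have "L2_set (\<lambda>n. norm (hcoeff (X m) n - hcoeff (X k) n)) {..<N} \<le> e" if "k \<ge> K" for k
        using K[OF m that] L2_set_hcoeff_le[of "X m - X k" N]
        by (simp add: dist_norm minus_hardy.rep_eq)
      then show "\<exists>M. \<forall>k\<ge>M. L2_set (\<lambda>n. norm (hcoeff (X m) n - hcoeff (X k) n)) {..<N} \<le> e"
        by blast
    qed
    then show ?thesis by blast
  qed
  obtain K where K: "\<And>N. L2_set (\<lambda>n. norm (hcoeff (X K) n - a n)) {..<N} \<le> 1"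
    using key[of 1] by auto
  have "summable (\<lambda>n. (norm (hcoeff (X K) n - a n))\<^sup>2)"
  proof (rule bounded_imp_summable)
    fix N
    have "L2_set (\<lambda>n. norm (hcoeff (X K) n - a n)) {..<Suc N} \<le> 1" by (rule K)
    then have "(\<Sum>n<Suc N. (norm (hcoeff (X K) n - a n))\<^sup>2) \<le> 1\<^sup>2"
      unfolding L2_set_def by (rule sqrt_le_D)
    then show "(\<Sum>n\<le>N. (norm (hcoeff (X K) n - a n))\<^sup>2) \<le> 1"
      by (simp add: lessThan_Suc_atMost)
  qed simp
  from square_summable_add[OF this, of "\<lambda>n. - hcoeff (X K) n"]
  have "summable (\<lambda>n. (norm (a n))\<^sup>2)" by (simp add: summable_hcoeff)
  then have ca: "hcoeff (Abs_hardy a) = a" by (simp add: Abs_hardy_inverse)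
  have "X \<longlonglongrightarrow> Abs_hardy a"
  proof (rule metric_LIMSEQ_I)
    fix e :: real assume "e > 0"
    then obtain K where "\<And>m N. m \<ge> K \<Longrightarrow> L2_set (\<lambda>n. norm (hcoeff (X m) n - a n)) {..<N} \<le> e / 2"
      using key[of "e / 2"] by auto
    then have "norm (X m - Abs_hardy a) \<le> e / 2" if "m \<ge> K" for m
      using that by (intro norm_hardy_leI) (simp add: minus_hardy.rep_eq ca)
    then show "\<exists>K. \<forall>m\<ge>K. dist (X m) (Abs_hardy a) < e"
      using \<open>e > 0\<close> by (intro exI[of _ K]) (fastforce simp: dist_norm)
  qed
  then show "convergent X" by (auto simp: convergent_def)
qed

end

text \<open>The value at \<open>z\<close> of the power series; only used for \<open>cmod z < 1\<close>, where it converges.\<close>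

definition hardy_eval :: "'a::complex_hilbert hardy \<Rightarrow> complex \<Rightarrow> 'a" where
  "hardy_eval f z = (\<Sum>n. z ^ n *\<^sub>C hcoeff f n)"

lift_definition hardy_shift :: "'a::complex_hilbert hardy \<Rightarrow> 'a hardy"
  is "\<lambda>a n. case n of 0 \<Rightarrow> 0 | Suc m \<Rightarrow> a m"
  by (subst summable_Suc_iff [symmetric]) simp

lift_definition hardy_const :: "'a::complex_hilbert \<Rightarrow> 'a hardy"
  is "\<lambda>x n. if n = 0 then x else 0"
  by (subst summable_Suc_iff [symmetric]) simp

lemma summable_hardy_eval:
  assumes "cmod z < 1"
  shows "summable (\<lambda>n. z ^ n *\<^sub>C hcoeff f n)"
proof (rule summable_comparison_test')
  show "summable (\<lambda>n. norm f * cmod z ^ n)"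
    using assms by (intro summable_mult summable_geometric) simp
  show "norm (z ^ n *\<^sub>C hcoeff f n) \<le> norm f * cmod z ^ n" for n
    using mult_right_mono[OF norm_hcoeff_le[of f n], of "cmod z ^ n"]
    by (simp add: norm_power mult.commute)
qed

lemma bounded_linear_scaleC: "bounded_linear (\<lambda>x::'a::complex_hilbert. c *\<^sub>C x)"
  by (rule bounded_linear_intro[of _ "cmod c"])
    (auto simp: scaleC_add_right scaleR_scaleC scaleC_scaleC mult.commute)

lemma hardy_eval_const: "hardy_eval (hardy_const x) z = x"
proof -
  have "(\<lambda>n. z ^ n *\<^sub>C hcoeff (hardy_const x) n) = (\<lambda>n. if n = 0 then x else 0)"
    by (auto simp: fun_eq_iff hardy_const.rep_eq)
  then show ?thesis
    unfolding hardy_eval_def using sums_single[of 0 "\<lambda>_. x"] by (simp add: sums_iff eq_commute)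
qed

lemma hardy_eval_shift:
  assumes "cmod z < 1"
  shows "hardy_eval (hardy_shift f) z = z *\<^sub>C hardy_eval f z"
proof -
  have "hardy_eval (hardy_shift f) z = (\<Sum>n. z ^ Suc n *\<^sub>C hcoeff f n)"
    unfolding hardy_eval_def
    using suminf_split_head[OF summable_hardy_eval[OF assms, of "hardy_shift f"]]
    by (simp add: hardy_shift.rep_eq)
  also have "\<dots> = z *\<^sub>C hardy_eval f z"
    unfolding hardy_eval_def
    by (subst bounded_linear.suminf[OF bounded_linear_scaleC summable_hardy_eval[OF assms]])
      (simp add: scaleC_scaleC)
  finally show ?thesis .
qed


section \<open>Bounded analytic operator functions and multiplication operators\<close>

text \<open>Elements of the library type of bounded operators are only real-linear, so complex linearity
  is demanded of the values \<open>\<Phi> z\<close>, and of the Frechet derivative of \<open>\<Phi>\<close> (with respect to the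
  operator norm) to obtain complex differentiability. Values of \<open>\<Phi>\<close> outside the disc are
  irrelevant.\<close>

definition H_infinity :: "(complex \<Rightarrow> ('b::complex_hilbert \<Rightarrow>\<^sub>L 'a::complex_hilbert)) set" where
  "H_infinity = {\<Phi>.
     (\<forall>z\<in>ball 0 1. \<forall>c x. blinfun_apply (\<Phi> z) (c *\<^sub>C x) = c *\<^sub>C blinfun_apply (\<Phi> z) x) \<and>
     (\<forall>z\<in>ball 0 1. \<exists>\<Phi>'. (\<Phi> has_derivative \<Phi>') (at z) \<and> 
        (\<forall>h x. blinfun_apply (\<Phi>' h) x = h *\<^sub>C blinfun_apply (\<Phi>' 1) x)) \<and>
     bounded (\<Phi> ` ball 0 1)}"

text \<open>The graph of \<open>M\<^sub>\<Phi>\<close>: \<open>mult_rel \<Phi> f g\<close> says that \<open>g = \<Phi> f\<close>. It is single-valued because a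
  power series is determined by its values on the disc.\<close>

definition mult_rel ::
  "(complex \<Rightarrow> ('b::complex_hilbert \<Rightarrow>\<^sub>L 'a::complex_hilbert)) \<Rightarrow> 'b hardy \<Rightarrow> 'a hardy \<Rightarrow> bool" where
  "mult_rel \<Phi> f g \<longleftrightarrow> (\<forall>z\<in>ball 0 1. hardy_eval g z = \<Phi> z (hardy_eval f z))"

definition mult_range ::
  "(complex \<Rightarrow> ('b::complex_hilbert \<Rightarrow>\<^sub>L 'a::complex_hilbert)) \<Rightarrow> 'a hardy set" where
  "mult_range \<Phi> = {g. \<exists>f. mult_rel \<Phi> f g}"

definition inner_function ::
  "(complex \<Rightarrow> ('b::complex_hilbert \<Rightarrow>\<^sub>L 'a::complex_hilbert)) \<Rightarrow> bool" where
  "inner_function \<Phi> \<longleftrightarrow> \<Phi> \<in> H_infinity \<and> (\<forall>f. \<exists>g. mult_rel \<Phi> f g \<and> norm g = norm f)"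


section \<open>Brownian shifts and canonical representations of their invariant subspaces\<close>

definition brownian_shift ::
  "real \<Rightarrow> real \<Rightarrow> 'a::complex_hilbert hardy \<times> 'a \<Rightarrow> 'a hardy \<times> 'a" where
  "brownian_shift \<sigma> \<theta> = (\<lambda>(f, x). (hardy_shift f + \<sigma> *\<^sub>R hardy_const x, cis \<theta> *\<^sub>C x))"

definition type_I :: "('a::complex_hilbert hardy \<times> 'a) set \<Rightarrow> bool" where
  "type_I M \<longleftrightarrow> M \<subseteq> UNIV \<times> {0}"

definition type_II :: "('a::complex_hilbert hardy \<times> 'a) set \<Rightarrow> bool" where
  "type_II M \<longleftrightarrow> \<not> M \<subseteq> UNIV \<times> {0}"

text \<open>\<open>G_rel \<sigma> \<theta> \<Phi> (g, y) x\<close> says that $g = (\Phi x - \sigma y) / (z - e^{i\theta})$.\<close>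

definition G_rel ::
  "real \<Rightarrow> real \<Rightarrow> (complex \<Rightarrow> ('b::complex_hilbert \<Rightarrow>\<^sub>L 'a::complex_hilbert)) \<Rightarrow>
    'a hardy \<times> 'a \<Rightarrow> 'b \<Rightarrow> bool" where
  "G_rel \<sigma> \<theta> \<Phi> = (\<lambda>(g, y) x.
     \<forall>z\<in>ball 0 1. hardy_eval g z = inverse (z - cis \<theta>) *\<^sub>C (\<Phi> z x - \<sigma> *\<^sub>R y))"

definition G_set ::
  "real \<Rightarrow> real \<Rightarrow> (complex \<Rightarrow> ('b::complex_hilbert \<Rightarrow>\<^sub>L 'a::complex_hilbert)) \<Rightarrow>
    ('a hardy \<times> 'a) set" where
  "G_set \<sigma> \<theta> \<Phi> = {u. \<exists>x. G_rel \<sigma> \<theta> \<Phi> u x}"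

text \<open>The Hilbert space \<open>E\<^sub>1\<close> (resp. \<open>E\<^sub>2\<close>) of the representation is the type \<open>'b\<close>.\<close>

definition canonical_I ::
  "('a::complex_hilbert hardy \<times> 'a) set \<Rightarrow> (complex \<Rightarrow> ('b::complex_hilbert \<Rightarrow>\<^sub>L 'a)) \<Rightarrow> bool" where
  "canonical_I M \<Phi> \<longleftrightarrow>
     (\<exists>x::'b. x \<noteq> 0) \<and> inner_function \<Phi> \<and> M = mult_range \<Phi> \<times> {0}"

definition canonical_II ::
  "real \<Rightarrow> real \<Rightarrow> ('a::complex_hilbert hardy \<times> 'a) set \<Rightarrow>
    (complex \<Rightarrow> ('b::complex_hilbert \<Rightarrow>\<^sub>L 'a)) \<Rightarrow> ('a hardy \<times> 'a) set \<Rightarrow> bool" where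
  "canonical_II \<sigma> \<theta> M \<Phi> \<G> \<longleftrightarrow>
     (\<exists>x::'b. x \<noteq> 0) \<and> inner_function \<Phi> \<and>
     \<G> \<subseteq> G_set \<sigma> \<theta> \<Phi> \<and> (\<exists>u\<in>\<G>. u \<noteq> 0) \<and>
     is_orthogonal_sum M (closed_cspan \<G>) (mult_range \<Phi> \<times> {0})"

end

theory Submission
  imports Defs
begin

text \<open>Write \<open>B\<close> for a Brownian shift of angle \<open>\<theta>\<close>. The identity \<open>\<parallel>B (f, x)\<parallel>\<^sup>2 = \<parallel>(f, x)\<parallel>\<^sup>2 + \<sigma>\<^sup>2
  \<parallel>x\<parallel>\<^sup>2\<close> shows that the vectors of an invariant subspace \<open>M\<close> on which \<open>B\<close> preserves the norm are
  those with vanishing second component. This isometric part is a unitary invariant of the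
  restriction of \<open>B\<close> to \<open>M\<close>. It is all of \<open>M\<close> precisely for Type I, so the two types are never
  equivalent.

  An inner function \<open>\<Phi>\<close> acts as an isometry \<open>T\<close> that commutes with the shifts. A unitary between
  the ranges of two such isometries that commutes with the shift pulls back to a unitary between
  Hardy spaces, which has to map constants to constants because the constants are the orthogonal
  complement of the range of the shift (\<open>shift_unitary_constants\<close>). It therefore yields a unitary
  \<open>W\<close> between the coefficient spaces, and conversely any such \<open>W\<close> acts coefficientwise. For Type I
  this reduces the equivalence to equality of Hilbert dimensions; here one needs that orthonormal
  bases exist, that two of them are equipotent, and that a bijection of bases extends to a unitary
  (\<open>hilbert_dim_eq_iff_unitary\<close>).

  For Type II the formula \<open>g = (\<Phi> x - \<sigma> y) / (z - cis \<theta>)\<close> says exactly that \<open>u = (g, y)\<close> is an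
  eigenvector up to an error: \<open>B u = cis \<theta> u + (\<Phi> x, 0)\<close>. Such \<open>u\<close> form a closed subspace, which
  contains the closed span \<open>N\<close> of the generators. A norm comparison shows that \<open>N\<close> meets the first
  summand only in \<open>0\<close>, so the isometric part of \<open>M\<close> is exactly the range of \<open>\<Phi>\<close> and \<open>N\<close> is its
  orthogonal complement. An intertwining unitary thus preserves both summands, and the two
  components of the intertwining relation on \<open>N\<close> say that the eigenvalues \<open>cis \<theta>\<close> agree and that
  \<open>W\<close> carries the error vector of \<open>u\<close> to that of its image. Conversely these data glue to an
  intertwining unitary (\<open>type_II_equivalence_imp\<close>, \<open>type_II_equivalence_if\<close>).\<close>

section \<open>Inner products and unitaries on subspaces\<close>

lemma cinner_zero_left [simp]: "cinner 0 x = 0"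
  using cinner_scaleC_left[of 0 0 x] by simp

lemma cinner_zero_right [simp]: "cinner x 0 = 0"
  using cinner_scaleC_right[of x 0 0] by simp

lemma cinner_diff_left: "cinner (x - y) z = cinner x z - cinner (y::'a::complex_hilbert) z"
  by (metis add_diff_cancel cinner_add_left diff_add_cancel)

lemma cinner_sum_left: "cinner (\<Sum>i\<in>I. f i) y = (\<Sum>i\<in>I. cinner (f i :: 'a::complex_hilbert) y)"
  by (induction I rule: infinite_finite_induct) (auto simp: cinner_add_left)

lemma cinner_eq_zero_commute: "cinner x y = 0 \<longleftrightarrow> cinner y (x::'a::complex_hilbert) = 0"
  by (metis cinner_commute complex_cnj_zero_iff)

lemma cinner_self_eq_zero: "cinner x x = 0 \<longleftrightarrow> x = (0::'a::complex_hilbert)"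
  by (simp add: cinner_self)

lemma Re_cinner_self: "Re (cinner x x) = (norm (x::'a::complex_hilbert))\<^sup>2"
  by (simp add: cinner_self del: of_real_power)

lemma norm_add_power2:
  "(norm (x + y))\<^sup>2 = (norm x)\<^sup>2 + (norm (y::'a::complex_hilbert))\<^sup>2 + 2 * Re (cinner x y)"
proof -
  have "Re (cinner y x) = Re (cinner x y)"
    by (subst cinner_commute) simp
  then show ?thesis
    by (simp add: Re_cinner_self[symmetric] cinner_add_left cinner_add_right)
qed

lemma norm_add_orthogonal:
  "cinner x y = 0 \<Longrightarrow> (norm (x + y))\<^sup>2 = (norm x)\<^sup>2 + (norm (y::'a::complex_hilbert))\<^sup>2"
  by (simp add: norm_add_power2)

lemma bounded_linear_cinner_left: "bounded_linear (\<lambda>x::'a::complex_hilbert. cinner x y)"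
proof (rule bounded_linear_intro[of _ "1 + (norm y)\<^sup>2"])
  fix x z :: 'a and r :: real
  show "cinner (x + z) y = cinner x y + cinner z y" by (rule cinner_add_left)
  show "cinner (r *\<^sub>R x) y = r *\<^sub>R cinner x y"
    by (simp only: scaleR_scaleC[of r x] cinner_scaleC_left scaleR_conv_of_real)
  show "norm (cinner x y) \<le> norm x * (1 + (norm y)\<^sup>2)"
  proof (cases "x = 0")
    case False
    have "x = complex_of_real (norm x) *\<^sub>C sgn x"
      using False by (simp add: scaleR_scaleC[symmetric] sgn_div_norm)
    then have "cinner x y = norm x * cinner (sgn x) y"
      by (metis cinner_scaleC_left)
    moreover have "cmod (cinner (sgn x) y) \<le> 1 + (norm y)\<^sup>2"
      using cmod_cinner_le[of "sgn x" y] False by (simp add: norm_sgn)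
    ultimately show ?thesis
      by (simp add: norm_mult mult_left_mono)
  qed simp
qed

lemma csubspace_closure:
  assumes "csubspace (S::'a::complex_hilbert set)"
  shows "csubspace (closure S)"
proof (rule complex_vector.subspaceI)
  show "0 \<in> closure S"
    using complex_vector.subspace_0[OF assms] closure_subset by blast
  show "x + y \<in> closure S" if "x \<in> closure S" "y \<in> closure S" for x y
  proof -
    from that obtain f g where fg: "\<And>n. f n \<in> S" "f \<longlonglongrightarrow> x" "\<And>n. g n \<in> S" "g \<longlonglongrightarrow> y"
      unfolding closure_sequential by blast
    then have "\<forall>n. f n + g n \<in> S" "(\<lambda>n. f n + g n) \<longlonglongrightarrow> x + y"
      using complex_vector.subspace_add[OF assms] by (auto intro: tendsto_add)
    then show ?thesis unfolding closure_sequential by (intro exI conjI)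
  qed
  show "c *\<^sub>C x \<in> closure S" if "x \<in> closure S" for c x
  proof -
    from that obtain f where f: "\<And>n. f n \<in> S" "f \<longlonglongrightarrow> x"
      unfolding closure_sequential by blast
    then have "\<forall>n. c *\<^sub>C f n \<in> S" "(\<lambda>n. c *\<^sub>C f n) \<longlonglongrightarrow> c *\<^sub>C x"
      using complex_vector.subspace_scale[OF assms]
      by (auto intro: bounded_linear.tendsto[OF bounded_linear_scaleC])
    then show ?thesis unfolding closure_sequential by (intro exI conjI)
  qed
qed

lemma csubspace_closed_cspan: "csubspace (closed_cspan N)"
  unfolding closed_cspan_def by (intro csubspace_closure complex_vector.subspace_span)

lemma closed_cspan_minimal:
  "\<lbrakk>N \<subseteq> S; csubspace S; closed S\<rbrakk> \<Longrightarrow> closed_cspan N \<subseteq> S"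
  unfolding closed_cspan_def
  by (intro closure_minimal complex_vector.span_minimal)

lemma subset_closed_cspan: "N \<subseteq> closed_cspan N"
  unfolding closed_cspan_def
  using closure_subset complex_vector.span_superset by blast

lemmas csubspace_zero = complex_vector.subspace_0
lemmas csubspace_add = complex_vector.subspace_add
lemmas csubspace_scaleC = complex_vector.subspace_scale
lemmas csubspace_diff = complex_vector.subspace_diff

lemma unitary_betweenI:
  assumes "\<And>x y. x \<in> S \<Longrightarrow> y \<in> S \<Longrightarrow> U (x + y) = U x + U y"
    and "\<And>c x. x \<in> S \<Longrightarrow> U (c *\<^sub>C x) = c *\<^sub>C U x"
    and "\<And>x. x \<in> S \<Longrightarrow> norm (U x) = norm x" and "U ` S = T"
  shows "unitary_between S T U"
  using assms by (auto simp: unitary_between_def clinear_on_def)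

lemma
  assumes "unitary_between S T U"
  shows unitary_add: "\<And>x y. x \<in> S \<Longrightarrow> y \<in> S \<Longrightarrow> U (x + y) = U x + U y"
    and unitary_scaleC: "\<And>c x. x \<in> S \<Longrightarrow> U (c *\<^sub>C x) = c *\<^sub>C U x"
    and unitary_norm: "\<And>x. x \<in> S \<Longrightarrow> norm (U x) = norm x"
    and unitary_image: "U ` S = T"
    and unitary_in: "\<And>x. x \<in> S \<Longrightarrow> U x \<in> T"
  using assms by (auto simp: unitary_between_def clinear_on_def)

lemma unitary_diff:
  assumes "unitary_between S T U" "csubspace S" "x \<in> S" "y \<in> S"
  shows "U (x - y) = U x - U y"
  using unitary_add[OF assms(1), of "x - y" y] csubspace_diff[OF assms(2-4)] assms(4)
  by (simp add: algebra_simps)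

lemma unitary_inj_on:
  assumes "unitary_between S T U" "csubspace S"
  shows "inj_on U S"
proof (rule inj_onI)
  fix x y assume "x \<in> S" "y \<in> S" "U x = U y"
  then have "norm (x - y) = 0"
    using unitary_diff[OF assms] unitary_norm[OF assms(1), of "x - y"] csubspace_diff[OF assms(2)]
    by simp
  then show "x = y" by simp
qed

text \<open>Polarization: the real part of the inner product is determined by the norms of \<open>x\<close>, \<open>y\<close> and
  \<open>x + y\<close>, and the imaginary part is the real part for \<open>\<i> y\<close> in place of \<open>y\<close>.\<close>

lemma unitary_cinner:
  assumes U: "unitary_between S T U" and S: "csubspace S" and xy: "x \<in> S" "y \<in> S"
  shows "cinner (U x) (U y) = cinner x y"
proof -
  have Re: "Re (cinner (U x) (U v)) = Re (cinner x v)" if "v \<in> S" for v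
    using norm_add_power2[of x v] norm_add_power2[of "U x" "U v"] unitary_add[OF U xy(1) that]
      unitary_norm[OF U xy(1)] unitary_norm[OF U that]
      unitary_norm[OF U csubspace_add[OF S xy(1) that]] by simp
  have Im: "Im (cinner u v) = Re (cinner u (\<i> *\<^sub>C v))" for u v :: "'c::complex_hilbert"
    by (simp add: cinner_scaleC_right)
  show ?thesis
    using Re[OF xy(2)] Re[OF csubspace_scaleC[OF S xy(2)], of \<i>] unitary_scaleC[OF U xy(2)]
    by (simp add: complex_eq_iff Im)
qed

lemma unitary_between_comp:
  assumes "unitary_between S T U" "unitary_between T R V"
  shows "unitary_between S R (\<lambda>x. V (U x))"
  using assms unfolding unitary_between_def clinear_on_def by (auto simp: image_image[symmetric])

lemma unitary_between_inverse:
  assumes U: "unitary_between S T U" and S: "csubspace S"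
  shows "unitary_between T S (inv_into S U)"
proof -
  have inj: "inj_on U S" by (rule unitary_inj_on[OF U S])
  have in': "inv_into S U y \<in> S" and r: "U (inv_into S U y) = y" if "y \<in> T" for y
    using that unitary_image[OF U] by (auto intro: inv_into_into f_inv_into_f)
  have l: "inv_into S U (U x) = x" if "x \<in> S" for x
    using inj that by simp
  show ?thesis
  proof (rule unitary_betweenI)
    fix x y assume "x \<in> T" "y \<in> T"
    then show "inv_into S U (x + y) = inv_into S U x + inv_into S U y"
      using l[of "inv_into S U x + inv_into S U y"] by (simp add: unitary_add[OF U] in' r csubspace_add[OF S])
  next
    fix c x assume "x \<in> T"
    then show "inv_into S U (c *\<^sub>C x) = c *\<^sub>C inv_into S U x"
      using l[of "c *\<^sub>C inv_into S U x"] by (simp add: unitary_scaleC[OF U] in' r csubspace_scaleC[OF S])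
  next
    fix x assume "x \<in> T"
    then show "norm (inv_into S U x) = norm x"
      using unitary_norm[OF U in'[of x]] r by simp
  next
    show "inv_into S U ` T = S"
      using in' l unitary_in[OF U] by force
  qed
qed

lemma unitary_between_subset:
  "\<lbrakk>unitary_between S T U; R \<subseteq> S; U ` R = Q\<rbrakk> \<Longrightarrow> unitary_between R Q U"
  unfolding unitary_between_def clinear_on_def by blast

lemma is_orthogonal_sum_mem:
  assumes "is_orthogonal_sum M A B"
  shows "a \<in> A \<Longrightarrow> b \<in> B \<Longrightarrow> a + b \<in> M"
    and "v \<in> M \<Longrightarrow> \<exists>a\<in>A. \<exists>b\<in>B. v = a + b"
    and "a \<in> A \<Longrightarrow> b \<in> B \<Longrightarrow> cinner a b = 0"
  using assms by (auto simp: is_orthogonal_sum_def)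

lemma is_orthogonal_sum_unique:
  assumes M: "is_orthogonal_sum M A B" and A: "csubspace A" and B: "csubspace B"
    and in': "a \<in> A" "a' \<in> A" "b \<in> B" "b' \<in> B" and eq: "a + b = a' + b'"
  shows "a = a'" "b = b'"
proof -
  have d: "a - a' = b' - b" using eq by (simp add: algebra_simps)
  have "cinner (a - a') (b' - b) = 0"
    by (rule is_orthogonal_sum_mem(3)[OF M]) (use in' A B csubspace_diff in auto)
  then show "a = a'" unfolding d[symmetric] by (simp add: cinner_self_eq_zero)
  then show "b = b'" using eq by simp
qed

text \<open>A unitary that carries one summand of an orthogonal decomposition onto the corresponding
  summand carries the other summand along, because that is the orthogonal complement.\<close>

lemma unitary_orthogonal_complement:
  assumes U: "unitary_between M1 M2 U" and M1: "csubspace M1"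
    and s1: "is_orthogonal_sum M1 A1 B1" and s2: "is_orthogonal_sum M2 A2 B2"
    and z: "0 \<in> A1" "0 \<in> B1" "0 \<in> A2" "0 \<in> B2"
    and B: "U ` B1 = B2"
  shows "U ` A1 = A2"
proof -
  have sub1: "A1 \<subseteq> M1" "B1 \<subseteq> M1" and sub2: "A2 \<subseteq> M2" "B2 \<subseteq> M2"
    using is_orthogonal_sum_mem(1)[OF s1, of _ 0] is_orthogonal_sum_mem(1)[OF s1, of 0]
      is_orthogonal_sum_mem(1)[OF s2, of _ 0] is_orthogonal_sum_mem(1)[OF s2, of 0] z by auto
  show ?thesis
  proof
    show "U ` A1 \<subseteq> A2"
    proof
      fix v assume "v \<in> U ` A1"
      then obtain u where u: "u \<in> A1" "v = U u" by blast
      then have "v \<in> M2" using unitary_in[OF U] sub1 by blast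
      then obtain a b where ab: "a \<in> A2" "b \<in> B2" "v = a + b"
        using is_orthogonal_sum_mem(2)[OF s2] by blast
      obtain b' where b': "b' \<in> B1" "b = U b'" using ab(2) B by blast
      have "cinner v b = 0"
        using unitary_cinner[OF U M1, of u b'] is_orthogonal_sum_mem(3)[OF s1 u(1) b'(1)] u b' sub1 by auto
      moreover have "cinner a b = 0" by (rule is_orthogonal_sum_mem(3)[OF s2 ab(1,2)])
      ultimately have "b = 0" using ab(3) by (simp add: cinner_add_left cinner_self_eq_zero)
      then show "v \<in> A2" using ab by simp
    qed
    show "A2 \<subseteq> U ` A1"
    proof
      fix v assume v: "v \<in> A2"
      then obtain u where u: "u \<in> M1" "v = U u" using sub2 unitary_image[OF U] by blast
      obtain a b where ab: "a \<in> A1" "b \<in> B1" "u = a + b"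
        using is_orthogonal_sum_mem(2)[OF s1 u(1)] by blast
      have "cinner v (U b) = 0" by (rule is_orthogonal_sum_mem(3)[OF s2 v]) (use B ab in auto)
      then have "cinner u b = 0" using unitary_cinner[OF U M1 u(1), of b] ab sub1 u by auto
      moreover have "cinner a b = 0" by (rule is_orthogonal_sum_mem(3)[OF s1 ab(1,2)])
      ultimately have "b = 0" using ab(3) by (simp add: cinner_add_left cinner_self_eq_zero)
      then show "v \<in> U ` A1" using ab u by auto
    qed
  qed
qed

text \<open>Conversely, unitaries between corresponding summands glue to a unitary between the sums.\<close>

lemma unitary_orthogonal_sum:
  assumes s1: "is_orthogonal_sum M1 A1 B1" and s2: "is_orthogonal_sum M2 A2 B2"
    and A: "csubspace A1" and B: "csubspace B1"
    and UA: "unitary_between A1 A2 UA" and UB: "unitary_between B1 B2 UB"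
  obtains U where "unitary_between M1 M2 U" "\<And>a b. a \<in> A1 \<Longrightarrow> b \<in> B1 \<Longrightarrow> U (a + b) = UA a + UB b"
proof
  define P where "P v p \<longleftrightarrow> fst p \<in> A1 \<and> snd p \<in> B1 \<and> v = fst p + snd p" for v p
  define U where "U v = (let p = SOME p. P v p in UA (fst p) + UB (snd p))" for v
  show U: "U (a + b) = UA a + UB b" if "a \<in> A1" "b \<in> B1" for a b
  proof -
    have "P (a + b) (SOME p. P (a + b) p)"
      by (rule someI[of _ "(a, b)"]) (use that in \<open>simp add: P_def\<close>)
    then have "(SOME p. P (a + b) p) = (a, b)"
      using is_orthogonal_sum_unique[OF s1 A B that(1) _ that(2), of "fst (SOME p. P (a + b) p)"
          "snd (SOME p. P (a + b) p)"]
      unfolding P_def by (auto simp: prod_eq_iff)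
    then show ?thesis by (simp add: U_def)
  qed
  show "unitary_between M1 M2 U"
  proof (rule unitary_betweenI)
    fix x y assume "x \<in> M1" "y \<in> M1"
    then obtain a b a' b' where ab: "a \<in> A1" "b \<in> B1" "x = a + b" "a' \<in> A1" "b' \<in> B1" "y = a' + b'"
      using is_orthogonal_sum_mem(2)[OF s1] by meson
    have "U (x + y) = U ((a + a') + (b + b'))" using ab by (simp add: algebra_simps)
    also have "\<dots> = UA (a + a') + UB (b + b')"
      by (rule U) (use ab A B csubspace_add in auto)
    finally show "U (x + y) = U x + U y"
      using ab by (simp add: U unitary_add[OF UA] unitary_add[OF UB])
  next
    fix c x assume "x \<in> M1"
    then obtain a b where ab: "a \<in> A1" "b \<in> B1" "x = a + b"
      using is_orthogonal_sum_mem(2)[OF s1] by meson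
    have "U (c *\<^sub>C x) = UA (c *\<^sub>C a) + UB (c *\<^sub>C b)"
      unfolding ab(3) scaleC_add_right by (rule U) (use ab A B csubspace_scaleC in auto)
    then show "U (c *\<^sub>C x) = c *\<^sub>C U x"
      using ab by (simp add: U unitary_scaleC[OF UA] unitary_scaleC[OF UB] scaleC_add_right)
  next
    fix x assume "x \<in> M1"
    then obtain a b where ab: "a \<in> A1" "b \<in> B1" "x = a + b"
      using is_orthogonal_sum_mem(2)[OF s1] by meson
    have "(norm (U x))\<^sup>2 = (norm (UA a))\<^sup>2 + (norm (UB b))\<^sup>2"
      unfolding ab(3) U[OF ab(1,2)]
      by (intro norm_add_orthogonal is_orthogonal_sum_mem(3)[OF s2] unitary_in[OF UA]
          unitary_in[OF UB] ab)
    also have "\<dots> = (norm x)\<^sup>2"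
      using norm_add_orthogonal[OF is_orthogonal_sum_mem(3)[OF s1 ab(1,2)]] ab
      by (simp add: unitary_norm[OF UA] unitary_norm[OF UB])
    finally show "norm (U x) = norm x" by simp
  next
    show "U ` M1 = M2"
    proof
      show "U ` M1 \<subseteq> M2"
        using is_orthogonal_sum_mem(2)[OF s1] is_orthogonal_sum_mem(1)[OF s2] U
          unitary_in[OF UA] unitary_in[OF UB] by (metis image_subsetI)
      show "M2 \<subseteq> U ` M1"
      proof
        fix y assume "y \<in> M2"
        then obtain a b where ab: "a \<in> A2" "b \<in> B2" "y = a + b"
          using is_orthogonal_sum_mem(2)[OF s2] by meson
        then obtain a' b' where "a' \<in> A1" "b' \<in> B1" "a = UA a'" "b = UB b'"
          using unitary_image[OF UA] unitary_image[OF UB] by blast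
        then show "y \<in> U ` M1"
          using ab U is_orthogonal_sum_mem(1)[OF s1] by (metis image_eqI)
      qed
    qed
  qed
qed

section \<open>Orthonormal bases and Hilbert dimension\<close>

text \<open>Indexed families rather than sets, so that a basis transported by a bijection keeps the
  index set of the original basis.\<close>

definition orthonormal :: "('i \<Rightarrow> 'a::complex_hilbert) \<Rightarrow> 'i set \<Rightarrow> bool" where
  "orthonormal e I \<longleftrightarrow> (\<forall>i\<in>I. \<forall>j\<in>I. cinner (e i) (e j) = (if i = j then 1 else 0))"

lemma orthonormal_subset: "orthonormal e I \<Longrightarrow> J \<subseteq> I \<Longrightarrow> orthonormal e J"
  unfolding orthonormal_def by blast

lemma cinner_orthonormal_sum:
  assumes "orthonormal e F" "finite F" "j \<in> F"
  shows "cinner (\<Sum>i\<in>F. c i *\<^sub>C e i) (e j) = c j"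
proof -
  have "cinner (\<Sum>i\<in>F. c i *\<^sub>C e i) (e j) = (\<Sum>i\<in>F. if i = j then c j else 0)"
    unfolding cinner_sum_left
    by (rule sum.cong) (use assms in \<open>auto simp: orthonormal_def cinner_scaleC_left\<close>)
  then show ?thesis using assms by simp
qed

lemma norm_orthonormal_sum:
  assumes "orthonormal e F" "finite F"
  shows "(norm (\<Sum>i\<in>F. c i *\<^sub>C e i))\<^sup>2 = (\<Sum>i\<in>F. (cmod (c i))\<^sup>2)"
  using assms(2,1)
proof (induction F rule: finite_induct)
  case (insert i F)
  have "cinner (e j) (e i) = 0" if "j \<in> F" for j
    using insert that by (auto simp: orthonormal_def)
  then have "cinner (\<Sum>i\<in>F. c i *\<^sub>C e i) (c i *\<^sub>C e i) = 0"
    by (simp add: cinner_sum_left cinner_scaleC_left cinner_scaleC_right)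
  moreover have "norm (e i) = 1"
    using insert.prems cinner_self[of "e i"] norm_ge_zero[of "e i"]
    by (auto simp: orthonormal_def power2_eq_1_iff simp del: of_real_power norm_ge_zero)
  moreover have "orthonormal e F" using insert.prems by (auto simp: orthonormal_def)
  ultimately show ?case
    using insert.hyps insert.IH
    by (subst sum.insert, simp_all add: add.commute[of "c i *\<^sub>C e i"] norm_add_orthogonal power_mult_distrib)
qed simp

lemma Bessel_inequality:
  assumes "orthonormal e F" "finite F"
  shows "(\<Sum>i\<in>F. (cmod (cinner x (e i)))\<^sup>2) \<le> (norm x)\<^sup>2"
proof -
  define p where "p = (\<Sum>i\<in>F. cinner x (e i) *\<^sub>C e i)"
  have "cinner (e i) (x - p) = 0" if "i \<in> F" for i
    using cinner_orthonormal_sum[OF assms that, of "\<lambda>i. cinner x (e i)"]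
    unfolding cinner_eq_zero_commute[of "e i"] p_def by (simp add: cinner_diff_left)
  moreover have "cinner p v = (\<Sum>i\<in>F. cinner x (e i) * cinner (e i) v)" for v
    by (simp add: p_def cinner_sum_left cinner_scaleC_left)
  ultimately have "cinner p (x - p) = 0" by simp
  from norm_add_orthogonal[OF this] have "(norm p)\<^sup>2 \<le> (norm x)\<^sup>2" by simp
  then show ?thesis unfolding p_def norm_orthonormal_sum[OF assms] .
qed

lemma summable_on_Bessel:
  assumes "orthonormal e I"
  shows "(\<lambda>i. (cmod (cinner x (e i)))\<^sup>2) summable_on I"
proof (rule nonneg_bdd_above_summable_on)
  show "bdd_above (sum (\<lambda>i. (cmod (cinner x (e i)))\<^sup>2) ` {F. F \<subseteq> I \<and> finite F})"
    by (rule bdd_aboveI2[where M = "(norm x)\<^sup>2"])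
      (use Bessel_inequality orthonormal_subset[OF assms] in auto)
qed simp

text \<open>Riesz--Fischer. By the Pythagorean theorem the differences of the finite partial sums are
  controlled by those of the series of squared moduli, so the partial sums form a Cauchy net,
  although the series need not converge absolutely.\<close>

lemma summable_on_orthonormal:
  assumes e: "orthonormal e I" and c: "(\<lambda>i. (cmod (c i))\<^sup>2) summable_on I"
  shows "(\<lambda>i. c i *\<^sub>C e i :: 'a::complex_hilbert) summable_on I"
proof -
  define f where "f i = c i *\<^sub>C e i" for i
  define q where "q F = (\<Sum>i\<in>F. (cmod (c i))\<^sup>2)" for F
  obtain L where "(q \<longlongrightarrow> L) (finite_subsets_at_top I)"
    using c unfolding summable_on_def has_sum_def q_def by blast
  then have lim: "eventually (\<lambda>F. dist (q F) L < d) (finite_subsets_at_top I)" if "d > 0" for d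
    using that by (simp add: tendsto_iff)
  have "\<exists>P. eventually P (finite_subsets_at_top I) \<and> (\<forall>F G. P F \<and> P G \<longrightarrow> dist (sum f F) (sum f G) < d)"
    if "d > 0" for d
  proof -
    \<comment> \<open>Two sums of squares that are within \<open>(d/4)\<^sup>2\<close> of the limit differ by less than
      \<open>(d/2)\<^sup>2\<close>; for nested index sets the vector sums then differ by less than \<open>d/2\<close>.\<close>
    have "(d/4)\<^sup>2 > 0" using \<open>d > 0\<close> by simp
    then obtain F0 where F0: "finite F0" "F0 \<subseteq> I"
      "\<And>F. finite F \<Longrightarrow> F0 \<subseteq> F \<Longrightarrow> F \<subseteq> I \<Longrightarrow> dist (q F) L < (d/4)\<^sup>2"
      using lim unfolding eventually_finite_subsets_at_top by metis
    have near: "norm (sum f F - sum f F0) < d / 2" if F: "finite F" "F0 \<subseteq> F" "F \<subseteq> I" for F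
    proof -
      have "norm (sum f F - sum f F0) ^ 2 = norm (sum f (F - F0)) ^ 2"
        using F by (simp add: sum_diff)
      also have "\<dots> = q (F - F0)"
        unfolding f_def q_def
        by (rule norm_orthonormal_sum) (use orthonormal_subset[OF e, of "F - F0"] F in auto)
      also have "\<dots> = q F - q F0" using F unfolding q_def by (simp add: sum_diff)
      also have "\<dots> < (d/4)\<^sup>2 + (d/4)\<^sup>2"
        using F0(3)[OF F] F0(3)[OF F0(1) order.refl F0(2)] by (simp add: dist_real_def)
      also have "\<dots> \<le> (d/2)\<^sup>2" by (simp add: power2_eq_square)
      finally show ?thesis by (rule power2_less_imp_less) (use \<open>d > 0\<close> in simp)
    qed
    show ?thesis
    proof (intro exI conjI allI impI)
      show "eventually (\<lambda>F. finite F \<and> F0 \<subseteq> F \<and> F \<subseteq> I) (finite_subsets_at_top I)"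
        using F0 by (auto simp: eventually_finite_subsets_at_top)
      fix F G assume *: "(finite F \<and> F0 \<subseteq> F \<and> F \<subseteq> I) \<and> (finite G \<and> F0 \<subseteq> G \<and> G \<subseteq> I)"
      have "dist (sum f F) (sum f G) \<le> dist (sum f F) (sum f F0) + dist (sum f G) (sum f F0)"
        by (rule dist_triangle2)
      also have "\<dots> < d" using near[of F] near[of G] * by (simp add: dist_norm)
      finally show "dist (sum f F) (sum f G) < d" .
    qed
  qed
  then have "cauchy_filter (filtermap (sum f) (finite_subsets_at_top I))"
    by (simp add: cauchy_filter_metric_filtermap)
  moreover have "complete (UNIV::'a set)"
    by (meson Cauchy_convergent UNIV_I complete_def convergent_def)
  ultimately obtain L' where "(sum f \<longlongrightarrow> L') (finite_subsets_at_top I)"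
    using complete_uniform[where S=UNIV] by (force simp: filterlim_def)
  then show ?thesis unfolding f_def summable_on_def has_sum_def by blast
qed

lemma cinner_orthonormal_has_sum:
  assumes e: "orthonormal e I" and s: "((\<lambda>i. c i *\<^sub>C e i) has_sum x) I" and j: "j \<in> I"
  shows "cinner x (e j) = c j"
proof (rule has_sum_unique)
  show "((\<lambda>i. cinner (c i *\<^sub>C e i) (e j)) has_sum cinner x (e j)) I"
    by (rule has_sum_bounded_linear[OF bounded_linear_cinner_left s])
  have "((\<lambda>i. if i = j then c j else 0) has_sum c j) I"
    using has_sum_finite[of "{j}" "\<lambda>i. if i = j then c j else 0"] j
    by (subst has_sum_cong_neutral[where T = "{j}"]) auto
  also have "?this \<longleftrightarrow> ((\<lambda>i. cinner (c i *\<^sub>C e i) (e j)) has_sum c j) I"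
    by (rule has_sum_cong) (use e j in \<open>auto simp: orthonormal_def cinner_scaleC_left\<close>)
  finally show "((\<lambda>i. cinner (c i *\<^sub>C e i) (e j)) has_sum c j) I" .
qed

lemma norm_orthonormal_has_sum:
  assumes e: "orthonormal e I" and s: "((\<lambda>i. c i *\<^sub>C e i) has_sum x) I"
  shows "((\<lambda>i. (cmod (c i))\<^sup>2) has_sum (norm x)\<^sup>2) I"
proof -
  have "((\<lambda>F. (norm (\<Sum>i\<in>F. c i *\<^sub>C e i))\<^sup>2) \<longlongrightarrow> (norm x)\<^sup>2) (finite_subsets_at_top I)"
    using s unfolding has_sum_def by (intro tendsto_intros)
  then show ?thesis
    unfolding has_sum_def
    by (rule Lim_transform_eventually)
      (auto intro!: eventually_finite_subsets_at_top_weakI norm_orthonormal_sum orthonormal_subset[OF e])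
qed

lemma orthonormal_basis_orthonormal: "orthonormal_basis A \<Longrightarrow> orthonormal id A"
  by (auto simp: orthonormal_basis_def orthonormal_def cinner_self)

lemma orthogonal_closed_cspan:
  assumes "\<And>a. a \<in> A \<Longrightarrow> cinner a y = 0" "x \<in> closed_cspan A"
  shows "cinner x (y::'a::complex_hilbert) = 0"
proof -
  have "closed_cspan A \<subseteq> {x. cinner x y = 0}"
  proof (rule closed_cspan_minimal)
    show "csubspace {x. cinner x y = 0}"
      by (rule complex_vector.subspaceI) (auto simp: cinner_add_left cinner_scaleC_left)
    show "closed {x. cinner x y = 0}"
      by (intro closed_Collect_eq continuous_intros linear_continuous_on bounded_linear_cinner_left)
  qed (use assms(1) in auto)
  then show ?thesis using assms(2) by auto
qed

text \<open>The sum of the Fourier series of \<open>x\<close> is the orthogonal projection of \<open>x\<close> to the closed span.\<close>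

lemma orthonormal_projection:
  assumes A: "orthonormal id A"
  obtains p where "((\<lambda>a. cinner x a *\<^sub>C a) has_sum p) A" "\<And>a. a \<in> A \<Longrightarrow> cinner (x - p) a = 0"
proof -
  have "(\<lambda>a. cinner x a *\<^sub>C id a) summable_on A"
    by (rule summable_on_orthonormal[OF A]) (use summable_on_Bessel[OF A, of x] in simp)
  then obtain p where p: "((\<lambda>a. cinner x a *\<^sub>C id a) has_sum p) A"
    by (auto simp: summable_on_def)
  show ?thesis
  proof (rule that)
    show "((\<lambda>a. cinner x a *\<^sub>C a) has_sum p) A" using p by simp
    show "cinner (x - p) a = 0" if "a \<in> A" for a
      using cinner_orthonormal_has_sum[OF A p that] by (simp add: cinner_diff_left)
  qed
qed

lemma orthonormal_basis_expansion:
  assumes "orthonormal_basis A"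
  shows "((\<lambda>a. cinner x a *\<^sub>C a) has_sum x) A"
proof -
  obtain p where p: "((\<lambda>a. cinner x a *\<^sub>C a) has_sum p) A" "\<And>a. a \<in> A \<Longrightarrow> cinner (x - p) a = 0"
    using orthonormal_projection[OF orthonormal_basis_orthonormal[OF assms]] by blast
  have "cinner (x - p) (x - p) = 0"
    by (rule orthogonal_closed_cspan[of A])
      (use p(2) assms in \<open>auto simp: orthonormal_basis_def cinner_eq_zero_commute[of _ "x - p"]\<close>)
  then show ?thesis using p(1) by (simp add: cinner_self_eq_zero)
qed

text \<open>A maximal orthonormal set is a basis: the component of a vector orthogonal to the closed
  span could otherwise be normalized and adjoined.\<close>

lemma ex_orthonormal_basis: "\<exists>A :: 'a::complex_hilbert set. orthonormal_basis A"
proof -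
  define ON where "ON = {A :: 'a set. orthonormal id A}"
  have "\<exists>M\<in>ON. \<forall>X\<in>ON. M \<subseteq> X \<longrightarrow> X = M"
  proof (rule subset_Zorn')
    fix C assume C: "subset.chain ON C"
    have "cinner a b = (if a = b then 1 else 0)" if "a \<in> \<Union>C" "b \<in> \<Union>C" for a b
    proof -
      obtain A1 A2 where "A1 \<in> C" "A2 \<in> C" "a \<in> A1" "b \<in> A2" using \<open>a \<in> \<Union>C\<close> \<open>b \<in> \<Union>C\<close> by blast
      moreover from this have "A1 \<subseteq> A2 \<or> A2 \<subseteq> A1" "A1 \<in> ON" "A2 \<in> ON"
        using C by (auto simp: subset_chain_def)
      ultimately show ?thesis by (auto simp: ON_def orthonormal_def)
    qed
    then show "\<Union>C \<in> ON" by (auto simp: ON_def orthonormal_def)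
  qed
  then obtain A where "A \<in> ON" and M: "\<forall>X\<in>ON. A \<subseteq> X \<longrightarrow> X = A" ..
  then have A: "orthonormal id A" by (simp add: ON_def)
  have max: "X = A" if "orthonormal id X" "A \<subseteq> X" for X
    using M that by (simp add: ON_def)
  have "x \<in> closed_cspan A" for x
  proof -
    obtain p where p: "((\<lambda>a. cinner x a *\<^sub>C a) has_sum p) A" "\<And>a. a \<in> A \<Longrightarrow> cinner (x - p) a = 0"
      using orthonormal_projection[OF A] by blast
    have "x = p"
    proof (rule ccontr)
      assume "x \<noteq> p"
      define b where "b = complex_of_real (inverse (norm (x - p))) *\<^sub>C (x - p)"
      have b: "cinner b b = 1"
        using \<open>x \<noteq> p\<close> by (simp add: b_def cinner_self norm_inverse del: of_real_power)
      have ba: "cinner b a = 0" "cinner a b = 0" if "a \<in> A" for a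
        using p(2)[OF that] by (simp_all add: b_def cinner_scaleC_left cinner_scaleC_right
            cinner_eq_zero_commute[of a "x - p"])
      have "orthonormal id (insert b A)"
        using A b ba by (auto simp: orthonormal_def)
      then have "b \<in> A" using max by blast
      then show False using ba b by simp
    qed
    moreover have "p \<in> closed_cspan A"
      unfolding closed_cspan_def
    proof (rule Lim_in_closed_set[OF closed_closure _ _ p(1)[unfolded has_sum_def]])
      show "eventually (\<lambda>F. (\<Sum>a\<in>F. cinner x a *\<^sub>C a) \<in> closure (cspan A)) (finite_subsets_at_top A)"
      proof (rule eventually_finite_subsets_at_top_weakI)
        fix F assume "F \<subseteq> A"
        then have "(\<Sum>a\<in>F. cinner x a *\<^sub>C a) \<in> cspan A"
          by (intro complex_vector.span_sum complex_vector.span_scale complex_vector.span_base) auto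
        then show "(\<Sum>a\<in>F. cinner x a *\<^sub>C a) \<in> closure (cspan A)" using closure_subset by blast
      qed
    qed simp
    ultimately show ?thesis by simp
  qed
  moreover have "norm a = 1" if "a \<in> A" for a
    using A that cinner_self[of a] norm_ge_zero[of a]
    by (auto simp: orthonormal_def power2_eq_1_iff simp del: of_real_power norm_ge_zero)
  ultimately show ?thesis
    using A unfolding orthonormal_basis_def orthonormal_def by (intro exI[of _ A]) auto
qed

lemma orthonormal_basis_hilbert_dim:
  obtains A :: "'a::complex_hilbert set" where "orthonormal_basis A" "hilbert_dim TYPE('a) = |A|"
  using someI_ex[OF ex_orthonormal_basis] unfolding hilbert_dim_def by blast

lemma orthonormal_independent:
  assumes "orthonormal id A"
  shows "complex_vector.independent A"
  unfolding complex_vector.independent_explicit_finite_subsets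
proof (intro allI impI ballI)
  fix S u v assume S: "S \<subseteq> A" "finite S" "(\<Sum>v\<in>S. u v *\<^sub>C v) = 0" "v \<in> S"
  show "u v = 0"
    using cinner_orthonormal_sum[OF orthonormal_subset[OF assms S(1)] S(2,4), of u] S(3) by simp
qed

lemma orthonormal_basis_finite_bound:
  assumes A: "orthonormal_basis (A :: 'a::complex_hilbert set)" and B: "orthonormal_basis (B :: 'a set)"
    and fin: "finite B"
  shows "finite A \<and> card A \<le> card B"
proof (rule complex_vector.independent_span_bound[OF fin])
  show "complex_vector.independent A"
    by (rule orthonormal_independent[OF orthonormal_basis_orthonormal[OF A]])
  have "x \<in> cspan B" for x
  proof -
    have "x = (\<Sum>b\<in>B. cinner x b *\<^sub>C b)"
      using orthonormal_basis_expansion[OF B, of x] has_sum_finite[OF fin] has_sum_unique by blast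
    also have "\<dots> \<in> cspan B"
      by (intro complex_vector.span_sum complex_vector.span_scale complex_vector.span_base)
    finally show ?thesis .
  qed
  then show "A \<subseteq> cspan B" by blast
qed

text \<open>Every element of \<open>A\<close> has a nonzero coefficient at some element of \<open>B\<close>, while by Bessel's
  inequality each element of \<open>B\<close> has only countably many nonzero coefficients with respect to \<open>A\<close>.\<close>

lemma orthonormal_basis_infinite_bound:
  assumes A: "orthonormal_basis (A :: 'a::complex_hilbert set)" and B: "orthonormal_basis (B :: 'a set)"
    and inf: "infinite B"
  shows "|A| \<le>o |B|"
proof -
  define N where "N b = {a \<in> A. cinner b a \<noteq> 0}" for b :: 'a
  have "A \<subseteq> (\<Union>b\<in>B. N b)"
  proof
    fix a assume a: "a \<in> A"
    show "a \<in> (\<Union>b\<in>B. N b)"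
    proof (rule ccontr)
      assume "a \<notin> (\<Union>b\<in>B. N b)"
      then have "cinner b a = 0" if "b \<in> B" for b using a that by (auto simp: N_def)
      then have "cinner a a = 0"
        by (rule orthogonal_closed_cspan) (use B in \<open>auto simp: orthonormal_basis_def\<close>)
      then show False using A a by (auto simp: orthonormal_basis_def cinner_self)
    qed
  qed
  then have "|A| \<le>o |\<Union>b\<in>B. N b|" by (rule card_of_mono1)
  also have "|\<Union>b\<in>B. N b| \<le>o |B|"
  proof (rule card_of_UNION_ordLeq_infinite[OF inf])
    show "|B| \<le>o |B|" by (rule card_of_mono1) simp
    show "\<forall>b\<in>B. |N b| \<le>o |B|"
    proof
      fix b
      have "countable {a\<in>A. (cmod (cinner b (id a)))\<^sup>2 \<noteq> 0}"
        by (rule summable_countable_real[OF summable_on_Bessel[OF orthonormal_basis_orthonormal[OF A]]])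
      then have "countable (N b)" by (simp add: N_def)
      then obtain f :: "'a \<Rightarrow> nat" where "inj_on f (N b)" by (rule countableE)
      then have "|N b| \<le>o |UNIV :: nat set|" using card_of_ordLeq by blast
      also have "|UNIV :: nat set| \<le>o |B|" using inf infinite_iff_card_of_nat by blast
      finally show "|N b| \<le>o |B|" .
    qed
  qed
  finally show ?thesis .
qed

text \<open>Infinite bases compare by the preceding countability argument and finite ones by linear
  algebra.\<close>

lemma orthonormal_basis_equipotent:
  assumes A: "orthonormal_basis (A :: 'a::complex_hilbert set)" and B: "orthonormal_basis (B :: 'a set)"
  shows "|A| =o |B|"
proof (cases "finite A \<or> finite B")
  case True
  then have fin: "finite A" "finite B"
    using orthonormal_basis_finite_bound A B by blast+
  then have "card A = card B"
    using orthonormal_basis_finite_bound[OF A B] orthonormal_basis_finite_bound[OF B A] by simp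
  then show ?thesis
    using fin card_of_ordIso finite_same_card_bij by blast
next
  case False
  then show ?thesis
    using orthonormal_basis_infinite_bound A B ordIso_iff_ordLeq by blast
qed

lemma unitary_orthonormal_basis:
  assumes U: "unitary_between UNIV UNIV U" and A: "orthonormal_basis A"
  shows "orthonormal_basis (U ` A)"
proof -
  have onA: "orthonormal id A" by (rule orthonormal_basis_orthonormal[OF A])
  have inj: "inj U" using unitary_inj_on[OF U] by simp
  have "x \<in> closed_cspan (U ` A)" for x
  proof -
    have linU: "bounded_linear U"
      by (rule bounded_linear_intro[of _ 1])
        (auto simp: unitary_add[OF U] scaleR_scaleC unitary_scaleC[OF U] unitary_norm[OF U])
    have "closed_cspan A \<subseteq> U -` closed_cspan (U ` A)"
    proof (rule closed_cspan_minimal)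
      show "A \<subseteq> U -` closed_cspan (U ` A)" using subset_closed_cspan by blast
      show "csubspace (U -` closed_cspan (U ` A))"
          by (rule complex_vector.subspaceI)
          (use csubspace_add[OF csubspace_closed_cspan] csubspace_scaleC[OF csubspace_closed_cspan]
            csubspace_zero[OF csubspace_closed_cspan]
            unitary_add[OF U] unitary_scaleC[OF U] linear_simps(3)[OF linU] in auto)
      show "closed (U -` closed_cspan (U ` A))"
        by (rule continuous_closed_vimage)
          (auto simp: closed_cspan_def linear_continuous_at[OF linU])
    qed
    then have "U (inv U x) \<in> closed_cspan (U ` A)"
      using A by (auto simp: orthonormal_basis_def)
    then show ?thesis
      using unitary_image[OF U] by (simp add: surj_f_inv_f)
  qed
  then show ?thesis
    using A inj unitary_norm[OF U] unitary_cinner[OF U]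
    by (auto simp: orthonormal_basis_def)
qed

text \<open>A bijection between orthonormal bases extends to the spaces by transporting Fourier
  coefficients.\<close>

lemma orthonormal_basis_bij_unitary:
  assumes A: "orthonormal_basis (A :: 'a::complex_hilbert set)"
    and B: "orthonormal_basis (B :: 'b::complex_hilbert set)" and h: "bij_betw h A B"
  shows "\<exists>U. unitary_between (UNIV :: 'a set) (UNIV :: 'b set) U"
proof -
  have onA: "orthonormal id A" by (rule orthonormal_basis_orthonormal[OF A])
  have onB: "orthonormal h A"
    using orthonormal_basis_orthonormal[OF B] h
    by (auto simp: orthonormal_def bij_betw_def inj_on_def)
  define U where "U x = infsum (\<lambda>a. cinner x a *\<^sub>C h a) A" for x
  have U: "((\<lambda>a. cinner x a *\<^sub>C h a) has_sum U x) A" for x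
    unfolding U_def
    by (intro has_sum_infsum summable_on_orthonormal[OF onB])
      (use summable_on_Bessel[OF onA, of x] in simp)
  have U_eq: "U x = y" if "((\<lambda>a. cinner x a *\<^sub>C h a) has_sum y) A" for x y
    by (rule has_sum_unique[OF U that])
  show ?thesis
  proof (intro exI unitary_betweenI)
    fix x y
    show "U (x + y) = U x + U y"
      by (rule U_eq) (use has_sum_add[OF U[of x] U[of y]] in \<open>simp add: cinner_add_left scaleC_add_left\<close>)
  next
    fix c x
    show "U (c *\<^sub>C x) = c *\<^sub>C U x"
      by (rule U_eq) (use has_sum_bounded_linear[OF bounded_linear_scaleC U[of x], of c] in
          \<open>simp add: cinner_scaleC_left scaleC_scaleC\<close>)
  next
    fix x
    have "((\<lambda>a. cinner x a *\<^sub>C id a) has_sum x) A"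
      using orthonormal_basis_expansion[OF A, of x] by simp
    from has_sum_unique[OF norm_orthonormal_has_sum[OF onB U] norm_orthonormal_has_sum[OF onA this]]
    have "(norm (U x))\<^sup>2 = (norm x)\<^sup>2" .
    then show "norm (U x) = norm x" by simp
  next
    have "y \<in> range U" for y
    proof -
      have y: "((\<lambda>a. cinner y (h a) *\<^sub>C h a) has_sum y) A"
        using orthonormal_basis_expansion[OF B, of y]
          has_sum_reindex_bij_betw[OF h, of "\<lambda>b. cinner y b *\<^sub>C b"] by simp
      have "(\<lambda>a. cinner y (h a) *\<^sub>C id a) summable_on A"
        by (rule summable_on_orthonormal[OF onA summable_on_Bessel[OF onB]])
      then obtain x where x: "((\<lambda>a. cinner y (h a) *\<^sub>C id a) has_sum x) A"
        by (auto simp: summable_on_def)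
      have "U x = y"
      proof (rule U_eq)
        have "cinner x a = cinner y (h a)" if "a \<in> A" for a
          using cinner_orthonormal_has_sum[OF onA x that] by simp
        then show "((\<lambda>a. cinner x a *\<^sub>C h a) has_sum y) A"
          using y by (subst has_sum_cong[where g = "\<lambda>a. cinner y (h a) *\<^sub>C h a"]) auto
      qed
      then show ?thesis by blast
    qed
    then show "range U = UNIV" by blast
  qed
qed

text \<open>The dimension refers to a chosen basis, so one direction needs that any two bases of a space
  are equipotent, applied to the chosen basis and the image of the other one.\<close>

lemma hilbert_dim_eq_iff_unitary:
  "hilbert_dim TYPE('a::complex_hilbert) =o hilbert_dim TYPE('b::complex_hilbert) \<longleftrightarrow>
    (\<exists>U. unitary_between (UNIV :: 'a set) (UNIV :: 'b set) U)"
proof -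
  obtain A :: "'a set" where A: "orthonormal_basis A" "hilbert_dim TYPE('a) = |A|"
    by (rule orthonormal_basis_hilbert_dim)
  obtain B :: "'b set" where B: "orthonormal_basis B" "hilbert_dim TYPE('b) = |B|"
    by (rule orthonormal_basis_hilbert_dim)
  show ?thesis
  proof
    assume "hilbert_dim TYPE('a) =o hilbert_dim TYPE('b)"
    then obtain h where "bij_betw h A B" using A B card_of_ordIso by metis
    then show "\<exists>U. unitary_between (UNIV :: 'a set) (UNIV :: 'b set) U"
      using orthonormal_basis_bij_unitary A B by blast
  next
    assume "\<exists>U. unitary_between (UNIV :: 'a set) (UNIV :: 'b set) U"
    then obtain U where U: "unitary_between (UNIV :: 'a set) (UNIV :: 'b set) U" ..
    have "bij_betw U A (U ` A)"
      using unitary_inj_on[OF U] by (auto simp: bij_betw_def inj_on_def)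
    then have "|A| =o |U ` A|" using card_of_ordIso by blast
    also have "|U ` A| =o |B|"
      by (rule orthonormal_basis_equipotent[OF unitary_orthonormal_basis[OF U A(1)] B(1)])
    finally show "hilbert_dim TYPE('a) =o hilbert_dim TYPE('b)" using A B by simp
  qed
qed

section \<open>Shift-intertwining isometries of Hardy spaces\<close>

lemma hcoeff_hardy_shift [simp]:
  "hcoeff (hardy_shift f) 0 = 0" "hcoeff (hardy_shift f) (Suc n) = hcoeff f n"
  by (simp_all add: hardy_shift.rep_eq)

lemma hcoeff_hardy_const [simp]:
  "hcoeff (hardy_const x) 0 = x" "hcoeff (hardy_const x) (Suc n) = 0"
  by (simp_all add: hardy_const.rep_eq)

lemma hardy_shift_add: "hardy_shift (f + g) = hardy_shift f + hardy_shift g"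
  by (rule hardy_eqI) (simp add: hardy_shift.rep_eq plus_hardy.rep_eq split: nat.split)

lemma hardy_shift_scaleC: "hardy_shift (c *\<^sub>C f) = c *\<^sub>C hardy_shift f"
  by (rule hardy_eqI) (simp add: hardy_shift.rep_eq scaleC_hardy.rep_eq split: nat.split)

lemma hardy_const_add: "hardy_const (x + y) = hardy_const x + hardy_const y"
  by (rule hardy_eqI) (simp add: hardy_const.rep_eq plus_hardy.rep_eq)

lemma hardy_const_scaleC: "hardy_const (c *\<^sub>C x) = c *\<^sub>C hardy_const x"
  by (rule hardy_eqI) (simp add: hardy_const.rep_eq scaleC_hardy.rep_eq)

lemma hardy_const_eq_iff: "hardy_const x = hardy_const y \<longleftrightarrow> x = y"
  by (metis hcoeff_hardy_const(1))

lemma hardy_const_zero [simp]: "hardy_const 0 = 0"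
  by (rule hardy_eqI) (simp add: hardy_const.rep_eq zero_hardy.rep_eq)

lemma norm_hardy_shift [simp]: "norm (hardy_shift f) = norm f"
  using suminf_split_head[OF summable_hcoeff[of "hardy_shift f"]]
  by (simp add: norm_hardy_def)

lemma norm_hardy_const [simp]: "norm (hardy_const x) = norm x"
  using suminf_split_head[OF summable_hcoeff[of "hardy_const x"]]
  by (simp add: norm_hardy_def)

lemma cinner_shift_const [simp]: "cinner (hardy_shift f) (hardy_const x) = 0"
proof -
  have "(\<lambda>n. cinner (hcoeff (hardy_shift f) n) (hcoeff (hardy_const x) n)) = (\<lambda>_. 0)"
    by (simp add: fun_eq_iff hardy_shift.rep_eq hardy_const.rep_eq split: nat.split)
  then show ?thesis by (simp add: cinner_hardy_def)
qed

lemma hardy_decompose: "\<exists>g. f = hardy_const (hcoeff f 0) + hardy_shift g"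
proof -
  have s: "summable (\<lambda>n. (norm (hcoeff f (Suc n)))\<^sup>2)"
    using summable_hcoeff[of f] by (subst summable_Suc_iff)
  have "f = hardy_const (hcoeff f 0) + hardy_shift (Abs_hardy (\<lambda>n. hcoeff f (Suc n)))"
  proof (rule hardy_eqI)
    show "hcoeff f n = hcoeff (hardy_const (hcoeff f 0) + hardy_shift (Abs_hardy (\<lambda>n. hcoeff f (Suc n)))) n"
      for n by (cases n) (use s in \<open>simp_all add: plus_hardy.rep_eq Abs_hardy_inverse\<close>)
  qed
  then show ?thesis ..
qed

text \<open>The constants are the orthogonal complement of the range of the shift.\<close>

lemma hardy_const_iff_orthogonal:
  "f \<in> range hardy_const \<longleftrightarrow> (\<forall>g. cinner (hardy_shift g) f = 0)"
proof
  assume f: "\<forall>g. cinner (hardy_shift g) f = 0"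
  obtain g where g: "f = hardy_const (hcoeff f 0) + hardy_shift g"
    using hardy_decompose by blast
  have "cinner (hardy_shift g) f = cinner (hardy_shift g) (hardy_shift g)"
    by (subst g) (simp add: cinner_add_right)
  then have "hardy_shift g = 0" using f by (simp add: cinner_self_eq_zero)
  then show "f \<in> range hardy_const" using g by (metis add_0_right rangeI)
qed auto

lemma hardy_shift_no_eigenvector:
  assumes "hardy_shift f = c *\<^sub>C f" "c \<noteq> 0"
  shows "f = 0"
proof -
  have "hcoeff f n = 0" for n
  proof (induction n)
    case 0
    have "c *\<^sub>C hcoeff f 0 = 0"
      using arg_cong[OF assms(1), of "\<lambda>f. hcoeff f 0"] by (simp add: scaleC_hardy.rep_eq)
    then show ?case using assms(2) complex_vector.scale_eq_0_iff by blast
  next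
    case (Suc n)
    have "c *\<^sub>C hcoeff f (Suc n) = 0"
      using arg_cong[OF assms(1), of "\<lambda>f. hcoeff f (Suc n)"] Suc by (simp add: scaleC_hardy.rep_eq)
    then show ?case using assms(2) complex_vector.scale_eq_0_iff by blast
  qed
  then show ?thesis by (intro hardy_eqI) (simp add: zero_hardy.rep_eq)
qed

text \<open>Since the constants are orthogonal to the range of the shift, a unitary that commutes with
  the shifts maps constants to constants. This recovers the coefficient space, up to unitary
  equivalence, from the shift.\<close>

lemma shift_unitary_constants:
  fixes V :: "'b::complex_hilbert hardy \<Rightarrow> 'c::complex_hilbert hardy"
  assumes V: "unitary_between UNIV UNIV V" and VS: "\<And>f. V (hardy_shift f) = hardy_shift (V f)"
  shows "\<exists>U. unitary_between (UNIV :: 'b set) (UNIV :: 'c set) U \<and> (\<forall>x. V (hardy_const x) = hardy_const (U x))"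
proof -
  define U where "U x = hcoeff (V (hardy_const x)) 0" for x
  have surj: "\<exists>f. g = V f" for g using unitary_image[OF V] by blast
  have const: "V f \<in> range hardy_const \<longleftrightarrow> f \<in> range hardy_const" for f
  proof -
    have "V f \<in> range hardy_const \<longleftrightarrow> (\<forall>g. cinner (hardy_shift (V g)) (V f) = 0)"
      unfolding hardy_const_iff_orthogonal using surj by metis
    also have "\<dots> \<longleftrightarrow> f \<in> range hardy_const"
      unfolding hardy_const_iff_orthogonal
      by (simp add: VS[symmetric] unitary_cinner[OF V])
    finally show ?thesis .
  qed
  have VU: "V (hardy_const x) = hardy_const (U x)" for x
    using const[of "hardy_const x"] by (auto simp: U_def)
  have "unitary_between UNIV UNIV U"
  proof (rule unitary_betweenI)
    show "U (x + y) = U x + U y" for x y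
      by (simp add: U_def hardy_const_add unitary_add[OF V] plus_hardy.rep_eq)
    show "U (c *\<^sub>C x) = c *\<^sub>C U x" for c x
      by (simp add: U_def hardy_const_scaleC unitary_scaleC[OF V] scaleC_hardy.rep_eq)
    show "norm (U x) = norm x" for x
      using unitary_norm[OF V, of "hardy_const x"] by (simp add: VU)
    have "y \<in> range U" for y
    proof -
      obtain f where f: "hardy_const y = V f" using surj by blast
      then have "f \<in> range hardy_const" unfolding const[symmetric] by (metis rangeI)
      then obtain x where "f = hardy_const x" by blast
      then have "hardy_const y = hardy_const (U x)" using f VU by simp
      then show ?thesis by (metis hcoeff_hardy_const(1) rangeI)
    qed
    then show "range U = UNIV" by blast
  qed
  then show ?thesis using VU by blast
qed

text \<open>The case distinction makes every value square-summable; the interesting case is an isometric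
  \<open>U\<close>.\<close>

lift_definition hardy_map :: "('b::complex_hilbert \<Rightarrow> 'c::complex_hilbert) \<Rightarrow> 'b hardy \<Rightarrow> 'c hardy"
  is "\<lambda>U a n. if \<forall>x. norm (U x) = norm x then U (a n) else 0"
proof -
  fix U :: "'b \<Rightarrow> 'c" and a :: "nat \<Rightarrow> 'b"
  assume "summable (\<lambda>n. (norm (a n))\<^sup>2)"
  then show "summable (\<lambda>n. (norm (if \<forall>x. norm (U x) = norm x then U (a n) else 0))\<^sup>2)"
    by (cases "\<forall>x. norm (U x) = norm x") (simp_all only: if_True if_False norm_zero, simp_all)
qed

text \<open>Conversely, a unitary between coefficient spaces acts coefficientwise on Hardy spaces.\<close>

lemma unitary_hardy_map:
  assumes U: "unitary_between UNIV UNIV U"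
  shows "unitary_between UNIV UNIV (hardy_map U)"
    and "hardy_map U (hardy_shift f) = hardy_shift (hardy_map U f)"
    and "hardy_map U (hardy_const x) = hardy_const (U x)"
proof -
  have n: "norm (U x) = norm x" for x using unitary_norm[OF U] by simp
  have c: "hcoeff (hardy_map U f) k = U (hcoeff f k)" for f k
    by (simp add: hardy_map.rep_eq n)
  have U0: "U 0 = 0" using n[of 0] by simp
  show "hardy_map U (hardy_shift f) = hardy_shift (hardy_map U f)"
    by (rule hardy_eqI) (simp add: c hardy_shift.rep_eq U0 split: nat.split)
  show "hardy_map U (hardy_const x) = hardy_const (U x)"
    by (rule hardy_eqI) (simp add: c hardy_const.rep_eq U0)
  show "unitary_between UNIV UNIV (hardy_map U)"
  proof (rule unitary_betweenI)
    show "hardy_map U (f + g) = hardy_map U f + hardy_map U g" for f g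
      by (rule hardy_eqI) (simp add: c plus_hardy.rep_eq unitary_add[OF U])
    show "hardy_map U (a *\<^sub>C f) = a *\<^sub>C hardy_map U f" for a f
      by (rule hardy_eqI) (simp add: c scaleC_hardy.rep_eq unitary_scaleC[OF U])
    show "norm (hardy_map U f) = norm f" for f
      by (simp add: norm_hardy_def c n)
    have "g \<in> range (hardy_map U)" for g
    proof -
      have r: "U (inv U y) = y" for y using unitary_image[OF U] by (simp add: surj_f_inv_f)
      then have "norm (inv U y) = norm y" for y using n[of "inv U y"] by simp
      then have s: "summable (\<lambda>k. (norm (inv U (hcoeff g k)))\<^sup>2)"
        using summable_hcoeff[of g] by simp
      have "g = hardy_map U (Abs_hardy (\<lambda>k. inv U (hcoeff g k)))"
        by (rule hardy_eqI) (simp add: c Abs_hardy_inverse s r)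
      then show ?thesis by blast
    qed
    then show "range (hardy_map U) = UNIV" by blast
  qed
qed

definition shift_isometry :: "('b::complex_hilbert hardy \<Rightarrow> 'a::complex_hilbert hardy) \<Rightarrow> bool" where
  "shift_isometry T \<longleftrightarrow> unitary_between UNIV (range T) T \<and> (\<forall>f. T (hardy_shift f) = hardy_shift (T f))"

lemma
  assumes "shift_isometry T"
  shows shift_isometry_add: "T (f + g) = T f + T g"
    and shift_isometry_scaleC: "T (c *\<^sub>C f) = c *\<^sub>C T f"
    and shift_isometry_norm: "norm (T f) = norm f"
    and shift_isometry_shift: "T (hardy_shift f) = hardy_shift (T f)"
    and shift_isometry_eq_iff: "T f = T g \<longleftrightarrow> f = g"
    and shift_isometry_zero: "T 0 = 0"
proof -
  have T: "unitary_between UNIV (range T) T" and S: "T (hardy_shift f) = hardy_shift (T f)"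
    using assms by (auto simp: shift_isometry_def)
  show "T (f + g) = T f + T g" "T (c *\<^sub>C f) = c *\<^sub>C T f" "norm (T f) = norm f"
    using unitary_add[OF T] unitary_scaleC[OF T] unitary_norm[OF T] by auto
  show "T (hardy_shift f) = hardy_shift (T f)" by (rule S)
  show "T f = T g \<longleftrightarrow> f = g" using unitary_inj_on[OF T] by (auto simp: inj_on_def)
  show "T 0 = 0" using unitary_norm[OF T, of 0] by simp
qed

lemma csubspace_shift_isometry_range:
  fixes T :: "'b::complex_hilbert hardy \<Rightarrow> 'a::complex_hilbert hardy"
  assumes T: "shift_isometry T"
  shows "csubspace (range T \<times> {0 :: 'c::complex_hilbert})"
proof (rule complex_vector.subspaceI)
  show "0 \<in> range T \<times> {0}" using shift_isometry_zero[OF T] by (auto simp: zero_prod_def intro: range_eqI[of _ _ 0])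
  show "u + v \<in> range T \<times> {0}" if uv: "u \<in> range T \<times> {0}" "v \<in> range T \<times> {0}" for u v :: "_ \<times> 'c"
  proof -
    obtain f g where "u = (T f, 0)" "v = (T g, 0)" using uv by auto
    then have "u + v = (T (f + g), 0)"
      by (simp add: shift_isometry_add[OF T])
    then show ?thesis by simp
  qed
  show "c *\<^sub>C u \<in> range T \<times> {0}" if "u \<in> range T \<times> {0}" for c and u :: "_ \<times> 'c"
    using that by (auto simp: scaleC_prod_def shift_isometry_scaleC[OF T, symmetric])
qed

lemma unitary_shift_isometry_embed:
  assumes T: "shift_isometry T"
  shows "unitary_between UNIV (range T \<times> {0}) (\<lambda>f. (T f, 0))"
  by (rule unitary_betweenI)
    (auto simp: shift_isometry_add[OF T] shift_isometry_scaleC[OF T] shift_isometry_norm[OF T]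
      scaleC_prod_def norm_prod_def)

text \<open>A holomorphic function vanishing on the disc has vanishing coefficients; testing against a
  fixed vector reduces this to scalar power series.\<close>

lemma hardy_eval_eqD:
  fixes f g :: "'a::complex_hilbert hardy"
  assumes "\<And>z. cmod z < 1 \<Longrightarrow> hardy_eval f z = hardy_eval g z"
  shows "f = g"
proof (rule hardy_eqI)
  fix n
  have "cinner (hcoeff f n) y = cinner (hcoeff g n) y" for y
  proof -
    define F where "F h = Abs_fps (\<lambda>n. cinner (hcoeff h n) y)" for h :: "'a hardy"
    have sums: "(\<lambda>n. fps_nth (F h) n * z ^ n) sums cinner (hardy_eval h z) y" if "cmod z < 1" for h z
    proof -
      have "(\<lambda>n. cinner (z ^ n *\<^sub>C hcoeff h n) y) sums cinner (hardy_eval h z) y"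
        unfolding hardy_eval_def
        by (intro bounded_linear.sums[OF bounded_linear_cinner_left] summable_sums summable_hardy_eval that)
      then show ?thesis by (simp add: F_def cinner_scaleC_left mult.commute)
    qed
    have rad: "fps_conv_radius (F h) > 0" for h
    proof -
      have "fps_conv_radius (F h) \<ge> norm (1/2 :: complex)"
        unfolding fps_conv_radius_def
        by (rule conv_radius_geI) (use sums_summable[OF sums[of "1/2" h]] in \<open>simp add: norm_divide\<close>)
      moreover have "ereal (norm (1/2 :: complex)) > 0" by simp
      ultimately show ?thesis by (rule less_le_trans[rotated])
    qed
    have "F f = F g"
    proof (rule eval_fps_eqD[OF rad rad])
      have "eventually (\<lambda>z. z \<in> ball 0 1) (nhds (0::complex))"
        by (rule eventually_nhds_in_open) auto
      then show "eventually (\<lambda>z. eval_fps (F f) z = eval_fps (F g) z) (nhds 0)"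
      proof (rule eventually_mono)
        fix z :: complex assume "z \<in> ball 0 1"
        then have z: "cmod z < 1" by simp
        show "eval_fps (F f) z = eval_fps (F g) z"
          using sums_unique[OF sums[OF z, of f]] sums_unique[OF sums[OF z, of g]] assms[OF z]
          by (simp add: eval_fps_def)
      qed
    qed
    then show ?thesis by (metis F_def fps_nth_Abs_fps)
  qed
  then have "cinner (hcoeff f n - hcoeff g n) (hcoeff f n - hcoeff g n) = 0"
    by (simp add: cinner_diff_left)
  then show "hcoeff f n = hcoeff g n" by (simp add: cinner_self_eq_zero)
qed

lemma hardy_eval_add:
  assumes "cmod z < 1"
  shows "hardy_eval (f + g) z = hardy_eval f z + hardy_eval g z"
  unfolding hardy_eval_def plus_hardy.rep_eq scaleC_add_right
  by (rule suminf_add[symmetric]; rule summable_hardy_eval[OF assms])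

lemma hardy_eval_scaleC:
  assumes "cmod z < 1"
  shows "hardy_eval (c *\<^sub>C f) z = c *\<^sub>C hardy_eval f z"
  unfolding hardy_eval_def
  by (subst bounded_linear.suminf[OF bounded_linear_scaleC summable_hardy_eval[OF assms]])
    (simp add: scaleC_scaleC scaleC_hardy.rep_eq mult.commute)

lemma hardy_eval_scaleR:
  "cmod z < 1 \<Longrightarrow> hardy_eval (r *\<^sub>R f) z = r *\<^sub>R hardy_eval f z"
  by (simp add: scaleR_scaleC hardy_eval_scaleC)

text \<open>The multiplication operator is well defined because an element of the Hardy space is
  determined by its values on the disc. After this step only the intertwining isometry matters.\<close>

lemma inner_function_multiplication:
  fixes \<Phi> :: "complex \<Rightarrow> ('b::complex_hilbert \<Rightarrow>\<^sub>L 'a::complex_hilbert)"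
  assumes "inner_function \<Phi>"
  obtains T where "shift_isometry T" "\<And>f g. mult_rel \<Phi> f g \<longleftrightarrow> g = T f"
proof -
  have lin: "\<Phi> z (c *\<^sub>C x) = c *\<^sub>C \<Phi> z x" if "cmod z < 1" for z c x
    using assms that by (auto simp: inner_function_def H_infinity_def)
  obtain T where T: "\<And>f. mult_rel \<Phi> f (T f)" "\<And>f. norm (T f) = norm f"
    using assms unfolding inner_function_def by metis
  have T_eq: "mult_rel \<Phi> f g \<longleftrightarrow> g = T f" for f g
    using T(1)[of f] by (auto simp: mult_rel_def intro!: hardy_eval_eqD)
  have ev: "hardy_eval (T f) z = \<Phi> z (hardy_eval f z)" if "cmod z < 1" for f z
    using T(1)[of f] that by (simp add: mult_rel_def)
  have "unitary_between UNIV (range T) T"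
  proof (rule unitary_betweenI)
    show "T (f + g) = T f + T g" for f g
      by (rule hardy_eval_eqD) (simp add: ev hardy_eval_add blinfun.add_right)
    show "T (c *\<^sub>C f) = c *\<^sub>C T f" for c f
      by (rule hardy_eval_eqD) (simp add: ev hardy_eval_scaleC lin)
  qed (use T in auto)
  moreover have "T (hardy_shift f) = hardy_shift (T f)" for f
    by (rule hardy_eval_eqD) (simp add: ev hardy_eval_shift lin)
  ultimately have "shift_isometry T" by (simp add: shift_isometry_def)
  then show ?thesis using T_eq that by blast
qed

lemma mult_range_eq_range:
  "(\<And>f g. mult_rel \<Phi> f g \<longleftrightarrow> g = T f) \<Longrightarrow> mult_range \<Phi> = range T"
  by (auto simp: mult_range_def)

section \<open>Restrictions of Brownian shifts\<close>

lemma brownian_shift_Pair [simp]: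
  "brownian_shift \<sigma> \<theta> (f, x) = (hardy_shift f + \<sigma> *\<^sub>R hardy_const x, cis \<theta> *\<^sub>C x)"
  by (simp add: brownian_shift_def)

lemma brownian_shift_add: "brownian_shift \<sigma> \<theta> (u + v) = brownian_shift \<sigma> \<theta> u + brownian_shift \<sigma> \<theta> v"
  by (cases u; cases v)
    (simp add: hardy_shift_add hardy_const_add scaleC_add_right scaleR_add_right)

lemma brownian_shift_scaleC: "brownian_shift \<sigma> \<theta> (c *\<^sub>C u) = c *\<^sub>C brownian_shift \<sigma> \<theta> u"
  by (cases u)
    (simp add: scaleC_prod_def hardy_shift_scaleC hardy_const_scaleC scaleC_add_right
      scaleR_scaleC scaleC_scaleC mult.commute)

text \<open>On the first summand the Brownian shift is isometric, and the covariance is what makes it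
  expand every other vector. Unitary equivalence therefore preserves the part of an invariant
  subspace that lies in the first summand.\<close>

lemma norm_brownian_shift:
  "(norm (brownian_shift \<sigma> \<theta> u))\<^sup>2 = (norm u)\<^sup>2 + \<sigma>\<^sup>2 * (norm (snd u))\<^sup>2"
proof (cases u)
  case (Pair f x)
  have "cinner (hardy_shift f) (\<sigma> *\<^sub>R hardy_const x) = 0"
    by (simp add: scaleR_scaleC cinner_scaleC_right)
  from norm_add_orthogonal[OF this] show ?thesis
    by (simp add: Pair norm_prod_def power_mult_distrib)
qed

lemma brownian_shift_isometric_iff:
  assumes "\<sigma> > 0"
  shows "norm (brownian_shift \<sigma> \<theta> u) = norm u \<longleftrightarrow> snd u = 0"
proof -
  have "norm (brownian_shift \<sigma> \<theta> u) = norm u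
      \<longleftrightarrow> (norm (brownian_shift \<sigma> \<theta> u))\<^sup>2 = (norm u)\<^sup>2"
    by (simp add: power2_eq_iff_nonneg)
  then show ?thesis using assms by (simp add: norm_brownian_shift)
qed

text \<open>A unitary intertwining the shifts on the ranges of two shift-intertwining isometries pulls
  back to a unitary that commutes with the shifts themselves.\<close>

lemma intertwiner_wandering_unitary:
  fixes T1 :: "'b::complex_hilbert hardy \<Rightarrow> 'a::complex_hilbert hardy"
    and T2 :: "'c::complex_hilbert hardy \<Rightarrow> 'd::complex_hilbert hardy"
  assumes T1: "shift_isometry T1" and T2: "shift_isometry T2"
    and U: "unitary_between (range T1 \<times> {0::'a}) (range T2 \<times> {0::'d}) U"
    and UB: "\<And>v. v \<in> range T1 \<times> {0} \<Longrightarrow> U (brownian_shift \<sigma>1 \<theta>1 v) = brownian_shift \<sigma>2 \<theta>2 (U v)"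
  obtains W where "unitary_between (UNIV :: 'b set) (UNIV :: 'c set) W"
    "\<And>x. U (T1 (hardy_const x), 0) = (T2 (hardy_const (W x)), 0)"
proof -
  define J where "J f = (T2 f, 0::'d)" for f
  define V where "V f = inv J (U (T1 f, 0))" for f
  have J: "unitary_between UNIV (range T2 \<times> {0}) J"
    unfolding J_def by (rule unitary_shift_isometry_embed[OF T2])
  have V: "unitary_between UNIV UNIV V"
    unfolding V_def
    by (rule unitary_between_comp[OF unitary_between_comp[OF unitary_shift_isometry_embed[OF T1] U]
          unitary_between_inverse[OF J]]) simp
  have UV: "U (T1 f, 0) = (T2 (V f), 0)" for f
  proof -
    have "U (T1 f, 0) \<in> range J"
      using unitary_in[OF U, of "(T1 f, 0)"] unitary_image[OF J] by simp
    then have "J (V f) = U (T1 f, 0)" unfolding V_def by (rule f_inv_into_f)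
    then show ?thesis by (simp add: J_def)
  qed
  have "V (hardy_shift f) = hardy_shift (V f)" for f
  proof -
    have "(T2 (V (hardy_shift f)), 0) = U (brownian_shift \<sigma>1 \<theta>1 (T1 f, 0))"
      by (simp add: UV[symmetric] shift_isometry_shift[OF T1])
    also have "\<dots> = (T2 (hardy_shift (V f)), 0)"
      by (subst UB) (simp_all add: UV shift_isometry_shift[OF T2])
    finally show ?thesis by (simp add: shift_isometry_eq_iff[OF T2])
  qed
  from shift_unitary_constants[OF V this] show ?thesis
    using that UV by auto
qed

text \<open>Conversely, \<open>T2\<close> after the coefficientwise action of \<open>W\<close> after the inverse of \<open>T1\<close>
  intertwines.\<close>

lemma wandering_unitary_intertwiner:
  fixes T1 :: "'b::complex_hilbert hardy \<Rightarrow> 'a::complex_hilbert hardy"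
    and T2 :: "'c::complex_hilbert hardy \<Rightarrow> 'd::complex_hilbert hardy"
  assumes T1: "shift_isometry T1" and T2: "shift_isometry T2"
    and W: "unitary_between (UNIV :: 'b set) (UNIV :: 'c set) W"
  obtains U where "unitary_between (range T1 \<times> {0::'a}) (range T2 \<times> {0::'d}) U"
    "\<And>v. v \<in> range T1 \<times> {0} \<Longrightarrow> U (brownian_shift \<sigma>1 \<theta>1 v) = brownian_shift \<sigma>2 \<theta>2 (U v)"
    "\<And>x. U (T1 (hardy_const x), 0) = (T2 (hardy_const (W x)), 0)"
proof -
  define J where "J f = (T1 f, 0::'a)" for f
  define U where "U v = (T2 (hardy_map W (inv J v)), 0::'d)" for v
  have J: "unitary_between UNIV (range T1 \<times> {0}) J"
    unfolding J_def by (rule unitary_shift_isometry_embed[OF T1])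
  have UJ: "U (T1 f, 0) = (T2 (hardy_map W f), 0)" for f
  proof -
    have "inv J (J f) = f" using unitary_inj_on[OF J] by simp
    then show ?thesis by (simp add: U_def J_def)
  qed
  have "unitary_between (range T1 \<times> {0}) (range T2 \<times> {0}) U"
    unfolding U_def
    by (rule unitary_between_comp[OF unitary_between_comp[OF unitary_between_inverse[OF J]
          unitary_hardy_map(1)[OF W]] unitary_shift_isometry_embed[OF T2]]) simp
  moreover have "U (brownian_shift \<sigma>1 \<theta>1 v) = brownian_shift \<sigma>2 \<theta>2 (U v)" if v: "v \<in> range T1 \<times> {0}" for v
    using v by (auto simp: UJ shift_isometry_shift[OF T1, symmetric] unitary_hardy_map(2)[OF W]
        shift_isometry_shift[OF T2])
  moreover have "U (T1 (hardy_const x), 0) = (T2 (hardy_const (W x)), 0)" for x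
    by (simp add: UJ unitary_hardy_map(3)[OF W])
  ultimately show ?thesis by (rule that)
qed

theorem type_I_equivalence:
  fixes T1 :: "'b::complex_hilbert hardy \<Rightarrow> 'a::complex_hilbert hardy"
    and T2 :: "'c::complex_hilbert hardy \<Rightarrow> 'd::complex_hilbert hardy"
  assumes T1: "shift_isometry T1" and T2: "shift_isometry T2"
  shows "unitarily_equivalent_on (range T1 \<times> {0}) (brownian_shift \<sigma>1 \<theta>1)
      (range T2 \<times> {0}) (brownian_shift \<sigma>2 \<theta>2)
    \<longleftrightarrow> hilbert_dim TYPE('b) =o hilbert_dim TYPE('c)"
  unfolding hilbert_dim_eq_iff_unitary
proof
  assume "unitarily_equivalent_on (range T1 \<times> {0}) (brownian_shift \<sigma>1 \<theta>1)
      (range T2 \<times> {0}) (brownian_shift \<sigma>2 \<theta>2)"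
  then show "\<exists>W. unitary_between (UNIV :: 'b set) (UNIV :: 'c set) W"
    unfolding unitarily_equivalent_on_def using intertwiner_wandering_unitary[OF T1 T2] by metis
next
  assume "\<exists>W. unitary_between (UNIV :: 'b set) (UNIV :: 'c set) W"
  then show "unitarily_equivalent_on (range T1 \<times> {0}) (brownian_shift \<sigma>1 \<theta>1)
      (range T2 \<times> {0}) (brownian_shift \<sigma>2 \<theta>2)"
    unfolding unitarily_equivalent_on_def using wandering_unitary_intertwiner[OF T1 T2] by metis
qed

text \<open>Isometry of the restriction is a unitary invariant, and it singles out Type I.\<close>

lemma unitarily_equivalent_type_I_iff:
  assumes "\<sigma>1 > 0" "\<sigma>2 > 0"
    and inv: "brownian_shift \<sigma>1 \<theta>1 ` M1 \<subseteq> M1"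
    and eq: "unitarily_equivalent_on M1 (brownian_shift \<sigma>1 \<theta>1) M2 (brownian_shift \<sigma>2 \<theta>2)"
  shows "type_I M1 \<longleftrightarrow> type_I M2"
proof -
  obtain U where U: "unitary_between M1 M2 U"
    "\<And>v. v \<in> M1 \<Longrightarrow> U (brownian_shift \<sigma>1 \<theta>1 v) = brownian_shift \<sigma>2 \<theta>2 (U v)"
    using eq unfolding unitarily_equivalent_on_def by blast
  have type_I: "type_I M \<longleftrightarrow> (\<forall>v\<in>M. snd v = 0)" for M :: "('e::complex_hilbert hardy \<times> 'e) set"
    by (force simp: type_I_def)
  have "snd (U v) = 0 \<longleftrightarrow> snd v = 0" if "v \<in> M1" for v
  proof -
    have "norm (brownian_shift \<sigma>2 \<theta>2 (U v)) = norm (brownian_shift \<sigma>1 \<theta>1 v)"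
      using that inv unitary_norm[OF U(1), of "brownian_shift \<sigma>1 \<theta>1 v"] U(2)[OF that] by auto
    then show ?thesis
      using brownian_shift_isometric_iff[OF assms(1), of \<theta>1 v]
        brownian_shift_isometric_iff[OF assms(2), of \<theta>2 "U v"] unitary_norm[OF U(1) that] by simp
  qed
  then show ?thesis
    unfolding type_I unitary_image[OF U(1), symmetric] by auto
qed

section \<open>Type II invariant subspaces\<close>

text \<open>Operator form of the canonical representation: \<open>T\<close> is multiplication by the inner function
  and \<open>N\<close> is the closed span of the generators. The vectors of \<open>N\<close> are eigenvectors of the
  Brownian shift up to an error \<open>(\<Phi> x, 0)\<close> in the wandering subspace of \<open>T\<close>.\<close>

locale type_II_model =
  fixes \<sigma> \<theta> :: real
    and T :: "'b::complex_hilbert hardy \<Rightarrow> 'a::complex_hilbert hardy"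
    and N M :: "('a hardy \<times> 'a) set"
  assumes \<sigma>: "\<sigma> > 0"
    and T: "shift_isometry T"
    and N: "csubspace N"
    and almost_eigenvector:
      "\<And>u. u \<in> N \<Longrightarrow> \<exists>x. brownian_shift \<sigma> \<theta> u = cis \<theta> *\<^sub>C u + (T (hardy_const x), 0)"
    and M: "csubspace M"
    and sum: "is_orthogonal_sum M N (range T \<times> {0})"
begin

text \<open>The error vector \<open>x\<close> of an almost eigenvector; for \<open>u = (g, y)\<close> it is the \<open>x\<close> in \<open>g = (\<Phi> x -
  \<sigma> y) / (z - cis \<theta>)\<close>.\<close>

definition defect :: "'a hardy \<times> 'a \<Rightarrow> 'b" where
  "defect u = (SOME x. brownian_shift \<sigma> \<theta> u = cis \<theta> *\<^sub>C u + (T (hardy_const x), 0))"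

lemma brownian_shift_defect:
  "u \<in> N \<Longrightarrow> brownian_shift \<sigma> \<theta> u = cis \<theta> *\<^sub>C u + (T (hardy_const (defect u)), 0)"
  unfolding defect_def by (rule someI_ex) (rule almost_eigenvector)

lemma defect_iff:
  assumes "u \<in> N"
  shows "brownian_shift \<sigma> \<theta> u = cis \<theta> *\<^sub>C u + (T (hardy_const x), 0) \<longleftrightarrow> x = defect u"
  unfolding brownian_shift_defect[OF assms]
  by (auto simp: shift_isometry_eq_iff[OF T] hardy_const_eq_iff)

lemma csubspace_range: "csubspace (range T \<times> {0::'a})"
  by (rule csubspace_shift_isometry_range[OF T])

lemma N_subset: "N \<subseteq> M" and R_subset: "range T \<times> {0} \<subseteq> M"
  using is_orthogonal_sum_mem(1)[OF sum, of _ 0] is_orthogonal_sum_mem(1)[OF sum, of 0]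
    csubspace_zero[OF N] csubspace_zero[OF csubspace_range] by auto

lemma N_orthogonal: "u \<in> N \<Longrightarrow> v \<in> range T \<times> {0} \<Longrightarrow> cinner u v = 0"
  by (rule is_orthogonal_sum_mem(3)[OF sum])

text \<open>Membership in \<open>N\<close> gives \<open>z g = cis \<theta> g + \<Phi> x\<close> with orthogonal summands on the right, and
  comparing norms gives \<open>x = 0\<close>. But the shift has no eigenvectors.\<close>

lemma N_first_summand:
  assumes "(g, 0) \<in> N"
  shows "g = 0"
proof -
  define x where "x = defect (g, 0)"
  have eq: "hardy_shift g = cis \<theta> *\<^sub>C g + T (hardy_const x)"
    using brownian_shift_defect[OF assms] by (simp add: x_def scaleC_prod_def)
  have "cinner (g, 0::'a) (T (hardy_const x), 0) = 0"
    by (rule N_orthogonal[OF assms]) simp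
  then have "cinner (cis \<theta> *\<^sub>C g) (T (hardy_const x)) = 0"
    by (simp add: cinner_prod_def cinner_scaleC_left)
  from norm_add_orthogonal[OF this] have "(norm g)\<^sup>2 = (norm g)\<^sup>2 + (norm x)\<^sup>2"
    unfolding eq[symmetric] by (simp add: shift_isometry_norm[OF T])
  then have "hardy_shift g = cis \<theta> *\<^sub>C g" using eq shift_isometry_zero[OF T] by simp
  then show ?thesis by (rule hardy_shift_no_eigenvector) simp
qed

lemma isometric_part:
  "range T \<times> {0} = {v \<in> M. norm (brownian_shift \<sigma> \<theta> v) = norm v}"
proof -
  have "v \<in> range T \<times> {0}" if "v \<in> M" "snd v = 0" for v
  proof -
    obtain u w where uw: "u \<in> N" "w \<in> range T \<times> {0}" "v = u + w"
      using is_orthogonal_sum_mem(2)[OF sum \<open>v \<in> M\<close>] by blast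
    then have "snd u = 0" using \<open>snd v = 0\<close> by auto
    then have "u = (fst u, 0)" by (simp add: prod_eq_iff)
    then have "u = 0" using N_first_summand[of "fst u"] uw(1) by (simp add: zero_prod_def)
    then show ?thesis using uw by simp
  qed
  then show ?thesis
    unfolding brownian_shift_isometric_iff[OF \<sigma>] using R_subset by auto
qed

end

text \<open>A unitary equivalence preserves the isometric parts, hence also their complements \<open>N\<close>. On
  the isometric parts it comes from a unitary \<open>W\<close> between the wandering subspaces, and comparing
  the two components of the intertwining relation on \<open>N\<close> gives equality of the eigenvalues and
  compatibility of \<open>W\<close> with the errors.\<close>

lemma type_II_equivalence_imp:
  fixes T1 :: "'b::complex_hilbert hardy \<Rightarrow> 'a::complex_hilbert hardy"
    and T2 :: "'c::complex_hilbert hardy \<Rightarrow> 'd::complex_hilbert hardy"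
  assumes m1: "type_II_model \<sigma>1 \<theta>1 T1 N1 M1" and m2: "type_II_model \<sigma>2 \<theta>2 T2 N2 M2"
    and inv: "brownian_shift \<sigma>1 \<theta>1 ` M1 \<subseteq> M1"
    and U: "unitary_between M1 M2 U"
    and UB: "\<And>v. v \<in> M1 \<Longrightarrow> U (brownian_shift \<sigma>1 \<theta>1 v) = brownian_shift \<sigma>2 \<theta>2 (U v)"
    and nz: "u0 \<in> N1" "u0 \<noteq> 0"
  obtains W where "cis \<theta>1 = cis \<theta>2" "unitary_between N1 N2 U"
    "unitary_between (UNIV :: 'b set) (UNIV :: 'c set) W"
    "\<And>u. u \<in> N1 \<Longrightarrow> W (type_II_model.defect \<sigma>1 \<theta>1 T1 u) = type_II_model.defect \<sigma>2 \<theta>2 T2 (U u)"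
proof -
  interpret A: type_II_model \<sigma>1 \<theta>1 T1 N1 M1 by (rule m1)
  interpret B: type_II_model \<sigma>2 \<theta>2 T2 N2 M2 by (rule m2)
  have norm: "norm (brownian_shift \<sigma>2 \<theta>2 (U v)) = norm (brownian_shift \<sigma>1 \<theta>1 v)" if "v \<in> M1" for v
    using that inv unitary_norm[OF U, of "brownian_shift \<sigma>1 \<theta>1 v"] UB[OF that] by auto
  have img: "U ` (range T1 \<times> {0}) = range T2 \<times> {0}"
    unfolding A.isometric_part B.isometric_part
    using norm unitary_norm[OF U] unitary_image[OF U] by force
  have VR: "unitary_between (range T1 \<times> {0}) (range T2 \<times> {0}) U"
    by (rule unitary_between_subset[OF U A.R_subset img])
  have "U ` N1 = N2"
    by (rule unitary_orthogonal_complement[OF U A.M A.sum B.sum _ _ _ _ img])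
      (intro csubspace_zero A.N A.csubspace_range B.N B.csubspace_range)+
  then have VN: "unitary_between N1 N2 U"
    by (rule unitary_between_subset[OF U A.N_subset])
  obtain W where W: "unitary_between UNIV UNIV W"
    "\<And>x. U (T1 (hardy_const x), 0) = (T2 (hardy_const (W x)), 0)"
    using intertwiner_wandering_unitary[OF A.T B.T VR] UB A.R_subset by blast
  have comp: "cis \<theta>1 *\<^sub>C U u = cis \<theta>2 *\<^sub>C U u" "W (A.defect u) = B.defect (U u)" if u: "u \<in> N1" for u
  proof -
    have Uu: "U u \<in> N2" by (rule unitary_in[OF VN u])
    have R1: "(T1 (hardy_const (A.defect u)), 0) \<in> M1" using A.R_subset by auto
    have cu: "cis \<theta>1 *\<^sub>C u \<in> M1" and uM: "u \<in> M1"
      using u A.N_subset csubspace_scaleC[OF A.N u, of "cis \<theta>1"] by blast+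
    have "cis \<theta>1 *\<^sub>C U u + (T2 (hardy_const (W (A.defect u))), 0) = U (brownian_shift \<sigma>1 \<theta>1 u)"
      unfolding A.brownian_shift_defect[OF u] unitary_add[OF U cu R1]
      by (simp add: W(2) unitary_scaleC[OF U uM])
    also have "\<dots> = cis \<theta>2 *\<^sub>C U u + (T2 (hardy_const (B.defect (U u))), 0)"
      by (simp add: UB[OF uM] B.brownian_shift_defect[OF Uu])
    finally have eq: "cis \<theta>1 *\<^sub>C U u + (T2 (hardy_const (W (A.defect u))), 0)
        = cis \<theta>2 *\<^sub>C U u + (T2 (hardy_const (B.defect (U u))), 0)" .
    show c: "cis \<theta>1 *\<^sub>C U u = cis \<theta>2 *\<^sub>C U u"
      by (rule is_orthogonal_sum_unique(1)[OF B.sum B.N B.csubspace_range _ _ _ _ eq])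
        (use csubspace_scaleC[OF B.N Uu] in auto)
    show "W (A.defect u) = B.defect (U u)"
      using eq unfolding c by (simp add: shift_isometry_eq_iff[OF B.T] hardy_const_eq_iff)
  qed
  have "U u0 \<noteq> 0" using unitary_norm[OF VN nz(1)] nz(2) by auto
  then have "cis \<theta>1 = cis \<theta>2" using comp(1)[OF nz(1)] complex_vector.scale_right_imp_eq by blast
  then show ?thesis using that VN W(1) comp(2) by blast
qed

text \<open>Glue the given unitary on \<open>N1\<close> to the intertwiner induced by \<open>W\<close> on the isometric parts. The
  only place where the Brownian shift mixes the two summands is the error term, and there \<open>W\<close>
  matches the errors.\<close>

lemma type_II_equivalence_if:
  fixes T1 :: "'b::complex_hilbert hardy \<Rightarrow> 'a::complex_hilbert hardy"
    and T2 :: "'c::complex_hilbert hardy \<Rightarrow> 'd::complex_hilbert hardy"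
  assumes m1: "type_II_model \<sigma>1 \<theta> T1 N1 M1" and m2: "type_II_model \<sigma>2 \<theta> T2 N2 M2"
    and VN: "unitary_between N1 N2 VN"
    and W: "unitary_between (UNIV :: 'b set) (UNIV :: 'c set) W"
    and comp: "\<And>u. u \<in> N1 \<Longrightarrow>
      W (type_II_model.defect \<sigma>1 \<theta> T1 u) = type_II_model.defect \<sigma>2 \<theta> T2 (VN u)"
  shows "unitarily_equivalent_on M1 (brownian_shift \<sigma>1 \<theta>) M2 (brownian_shift \<sigma>2 \<theta>)"
proof -
  interpret A: type_II_model \<sigma>1 \<theta> T1 N1 M1 by (rule m1)
  interpret B: type_II_model \<sigma>2 \<theta> T2 N2 M2 by (rule m2)
  obtain VR where VR: "unitary_between (range T1 \<times> {0}) (range T2 \<times> {0}) VR"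
    "\<And>v. v \<in> range T1 \<times> {0} \<Longrightarrow> VR (brownian_shift \<sigma>1 \<theta> v) = brownian_shift \<sigma>2 \<theta> (VR v)"
    "\<And>x. VR (T1 (hardy_const x), 0) = (T2 (hardy_const (W x)), 0)"
    using wandering_unitary_intertwiner[OF A.T B.T W, of \<sigma>1 \<theta> \<sigma>2 \<theta>] by blast
  obtain U where U: "unitary_between M1 M2 U"
    "\<And>u v. u \<in> N1 \<Longrightarrow> v \<in> range T1 \<times> {0} \<Longrightarrow> U (u + v) = VN u + VR v"
    using unitary_orthogonal_sum[OF A.sum B.sum A.N A.csubspace_range VN VR(1)] by blast
  have "U (brownian_shift \<sigma>1 \<theta> w) = brownian_shift \<sigma>2 \<theta> (U w)" if "w \<in> M1" for w
  proof -
    obtain u v where uv: "u \<in> N1" "v \<in> range T1 \<times> {0}" "w = u + v"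
      using is_orthogonal_sum_mem(2)[OF A.sum \<open>w \<in> M1\<close>] by blast
    define r where "r = (T1 (hardy_const (A.defect u)), 0::'a)"
    have r: "r \<in> range T1 \<times> {0}" by (simp add: r_def)
    have VRr: "VR r = (T2 (hardy_const (B.defect (VN u))), 0)"
      by (simp add: r_def VR(3) comp[OF uv(1)])
    have Bv: "brownian_shift \<sigma>1 \<theta> v \<in> range T1 \<times> {0}"
      using uv(2) by (auto simp: shift_isometry_shift[OF A.T, symmetric])
    have "brownian_shift \<sigma>1 \<theta> w = cis \<theta> *\<^sub>C u + (r + brownian_shift \<sigma>1 \<theta> v)"
      by (simp add: uv(3) brownian_shift_add A.brownian_shift_defect[OF uv(1)] r_def add.assoc)
    also have "U \<dots> = VN (cis \<theta> *\<^sub>C u) + VR (r + brownian_shift \<sigma>1 \<theta> v)"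
      by (rule U(2)) (use csubspace_scaleC[OF A.N uv(1)] csubspace_add[OF A.csubspace_range r Bv] in auto)
    also have "\<dots> = (cis \<theta> *\<^sub>C VN u + (T2 (hardy_const (B.defect (VN u))), 0)) + brownian_shift \<sigma>2 \<theta> (VR v)"
      by (simp add: unitary_scaleC[OF VN uv(1)] unitary_add[OF VR(1) r Bv] VR(2)[OF uv(2)]
          VRr add.assoc)
    also have "\<dots> = brownian_shift \<sigma>2 \<theta> (U w)"
      by (simp add: uv(3) U(2)[OF uv(1,2)] brownian_shift_add
          B.brownian_shift_defect[OF unitary_in[OF VN uv(1)]])
    finally show ?thesis .
  qed
  then show ?thesis using U(1) unfolding unitarily_equivalent_on_def by blast
qed

text \<open>Clearing the denominator, which does not vanish on the disc, turns the formula for \<open>g\<close> into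
  an identity between elements of the Hardy space.\<close>

lemma G_rel_iff_almost_eigenvector:
  fixes \<Phi> :: "complex \<Rightarrow> ('b::complex_hilbert \<Rightarrow>\<^sub>L 'a::complex_hilbert)"
  assumes T: "\<And>f g. mult_rel \<Phi> f g \<longleftrightarrow> g = T f"
  shows "G_rel \<sigma> \<theta> \<Phi> u x \<longleftrightarrow> brownian_shift \<sigma> \<theta> u = cis \<theta> *\<^sub>C u + (T (hardy_const x), 0)"
proof (cases u)
  case (Pair g y)
  have ev: "hardy_eval (T f) z = \<Phi> z (hardy_eval f z)" if "cmod z < 1" for f z
    using T[of f "T f"] that by (simp add: mult_rel_def)
  have pw: "hardy_eval g z = inverse (z - cis \<theta>) *\<^sub>C (\<Phi> z x - \<sigma> *\<^sub>R y) \<longleftrightarrow>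
      hardy_eval (hardy_shift g + \<sigma> *\<^sub>R hardy_const y) z
        = hardy_eval (cis \<theta> *\<^sub>C g + T (hardy_const x)) z" if z: "cmod z < 1" for z
  proof -
    have nz: "z - cis \<theta> \<noteq> 0" using z by auto
    have "hardy_eval (hardy_shift g + \<sigma> *\<^sub>R hardy_const y) z
        = hardy_eval (cis \<theta> *\<^sub>C g + T (hardy_const x)) z
      \<longleftrightarrow> (z - cis \<theta>) *\<^sub>C hardy_eval g z = \<Phi> z x - \<sigma> *\<^sub>R y"
      using z by (auto simp: hardy_eval_add hardy_eval_scaleR hardy_eval_scaleC hardy_eval_shift
          hardy_eval_const ev complex_vector.scale_left_diff_distrib algebra_simps)
    also have "\<dots> \<longleftrightarrow> hardy_eval g z = inverse (z - cis \<theta>) *\<^sub>C (\<Phi> z x - \<sigma> *\<^sub>R y)"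
      using nz by (metis complex_vector.scale_scale complex_vector.scale_one
          left_inverse right_inverse)
    finally show ?thesis by simp
  qed
  have "G_rel \<sigma> \<theta> \<Phi> u x \<longleftrightarrow> hardy_shift g + \<sigma> *\<^sub>R hardy_const y = cis \<theta> *\<^sub>C g + T (hardy_const x)"
    unfolding G_rel_def Pair using pw by (auto intro: hardy_eval_eqD)
  then show ?thesis by (simp add: Pair scaleC_prod_def)
qed

text \<open>The condition says that the bounded operator \<open>u \<mapsto> B u - cis \<theta> u\<close> maps \<open>u\<close> into the wandering
  subspace, which is closed as an isometric image of a complete space. The condition thus passes
  from generators to their closed span.\<close>

lemma closed_csubspace_almost_eigenvectors:
  fixes T :: "'b::complex_hilbert hardy \<Rightarrow> 'a::complex_hilbert hardy" and \<sigma> \<theta> :: real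
  assumes T: "shift_isometry T"
  defines "S \<equiv> {u. \<exists>x. brownian_shift \<sigma> \<theta> u = cis \<theta> *\<^sub>C u + (T (hardy_const x), 0)}"
  shows "csubspace S" "closed S"
proof -
  define D where "D u = brownian_shift \<sigma> \<theta> u - cis \<theta> *\<^sub>C u" for u :: "'a hardy \<times> 'a"
  define J where "J x = (T (hardy_const x), 0::'a)" for x
  have S: "S = D -` range J"
    by (auto simp: S_def D_def J_def algebra_simps)
  have Dadd: "D (u + v) = D u + D v" and Dscale: "D (c *\<^sub>C u) = c *\<^sub>C D u" for u v c
    by (simp_all add: D_def brownian_shift_add brownian_shift_scaleC scaleC_add_right
        complex_vector.scale_right_diff_distrib scaleC_scaleC mult.commute)
  have Jadd: "J (x + y) = J x + J y" and Jscale: "J (c *\<^sub>C x) = c *\<^sub>C J x" and Jnorm: "norm (J x) = norm x"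
    for x y c
    by (simp_all add: J_def hardy_const_add hardy_const_scaleC shift_isometry_add[OF T]
        shift_isometry_scaleC[OF T] shift_isometry_norm[OF T] scaleC_prod_def norm_prod_def)
  have J: "bounded_linear J"
    by (rule bounded_linear_intro[of _ 1]) (auto simp: Jadd scaleR_scaleC Jscale Jnorm)
  have D: "bounded_linear D"
  proof (rule bounded_linear_intro[of _ "sqrt (1 + \<sigma>\<^sup>2) + 1"])
    fix u :: "'a hardy \<times> 'a"
    have "norm (snd u) \<le> norm u" by (metis norm_snd_le prod.collapse)
    then have "\<sigma>\<^sup>2 * (norm (snd u))\<^sup>2 \<le> \<sigma>\<^sup>2 * (norm u)\<^sup>2"
      by (intro mult_left_mono power_mono) auto
    then have "(norm (brownian_shift \<sigma> \<theta> u))\<^sup>2 \<le> (1 + \<sigma>\<^sup>2) * (norm u)\<^sup>2"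
      unfolding norm_brownian_shift by (simp add: algebra_simps)
    from real_sqrt_le_mono[OF this] have "norm (brownian_shift \<sigma> \<theta> u) \<le> sqrt (1 + \<sigma>\<^sup>2) * norm u"
      by (simp add: real_sqrt_mult)
    moreover have "norm (D u) \<le> norm (brownian_shift \<sigma> \<theta> u) + norm (cis \<theta> *\<^sub>C u)"
      unfolding D_def by (rule norm_triangle_ineq4)
    ultimately show "norm (D u) \<le> norm u * (sqrt (1 + \<sigma>\<^sup>2) + 1)"
      by (simp add: algebra_simps)
  qed (simp_all add: Dadd scaleR_scaleC Dscale)
  show "csubspace S"
    unfolding S
  proof (rule complex_vector.subspaceI)
    show "0 \<in> D -` range J"
      using linear_simps(3)[OF D] linear_simps(3)[OF J] by (auto intro: range_eqI[of _ _ 0])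
    show "u + v \<in> D -` range J" if "u \<in> D -` range J" "v \<in> D -` range J" for u v
      using that by (auto simp: Dadd Jadd[symmetric])
    show "c *\<^sub>C u \<in> D -` range J" if "u \<in> D -` range J" for c u
      using that by (auto simp: Dscale Jscale[symmetric])
  qed
  have "complete (range J)"
    by (rule complete_isometric_image[OF zero_less_one subspace_UNIV J])
      (auto simp: Jnorm complete_eq_closed)
  then have "closed (range J)" by (simp add: complete_eq_closed)
  then show "closed S"
    unfolding S by (rule continuous_closed_vimage) (rule linear_continuous_at[OF D])
qed

lemma canonical_II_model:
  fixes \<Phi> :: "complex \<Rightarrow> ('b::complex_hilbert \<Rightarrow>\<^sub>L 'a::complex_hilbert)"
  assumes can: "canonical_II \<sigma> \<theta> M \<Phi> \<G>" and \<sigma>: "\<sigma> > 0" and M: "csubspace M"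
  obtains T where "type_II_model \<sigma> \<theta> T (closed_cspan \<G>) M"
    "\<And>u x. G_rel \<sigma> \<theta> \<Phi> u x \<longleftrightarrow> brownian_shift \<sigma> \<theta> u = cis \<theta> *\<^sub>C u + (T (hardy_const x), 0)"
proof -
  obtain T where T: "shift_isometry T" and mult: "\<And>f g. mult_rel \<Phi> f g \<longleftrightarrow> g = T f"
    using inner_function_multiplication can unfolding canonical_II_def by blast
  note G_rel = G_rel_iff_almost_eigenvector[OF mult, of \<sigma> \<theta>]
  have "\<G> \<subseteq> {u. \<exists>x. brownian_shift \<sigma> \<theta> u = cis \<theta> *\<^sub>C u + (T (hardy_const x), 0)}"
    using can by (auto simp: canonical_II_def G_set_def G_rel)
  from closed_cspan_minimal[OF this closed_csubspace_almost_eigenvectors[OF T]]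
  have "type_II_model \<sigma> \<theta> T (closed_cspan \<G>) M"
    using can mult_range_eq_range[OF mult] T \<sigma> M csubspace_closed_cspan
    by unfold_locales (auto simp: canonical_II_def)
  then show ?thesis using that G_rel by blast
qed

lemma cis_inject:
  assumes "cis a = cis b" "a \<in> {0..<2 * pi}" "b \<in> {0..<2 * pi}"
  shows "a = b"
proof -
  have "Arg2pi (cis t) = t" if "t \<in> {0..<2 * pi}" for t
    by (rule Arg2pi_unique[of 1]) (use that in \<open>auto simp: cis_conv_exp\<close>)
  then show ?thesis using assms by metis
qed

section \<open>Classification up to unitary equivalence\<close>

theorem theorem3p1:
  fixes \<theta>1 \<theta>2 \<sigma>1 \<sigma>2 :: real
    and M1 M2 :: "('e::complex_hilbert hardy \<times> 'e) set"
    and \<Phi>1 :: "complex \<Rightarrow> ('e1::complex_hilbert \<Rightarrow>\<^sub>L 'e)"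
    and \<Phi>2 :: "complex \<Rightarrow> ('e2::complex_hilbert \<Rightarrow>\<^sub>L 'e)"
    and \<G>1 \<G>2 :: "('e hardy \<times> 'e) set"
  assumes separable: "separable_space (euclidean :: 'e topology)"
    and angles: "\<theta>1 \<in> {0..<2 * pi}" "\<theta>2 \<in> {0..<2 * pi}"
    and covariances: "\<sigma>1 > 0" "\<sigma>2 > 0"
    and M1: "invariant_subspace (brownian_shift \<sigma>1 \<theta>1) M1" "M1 \<noteq> {0}"
    and M2: "invariant_subspace (brownian_shift \<sigma>2 \<theta>2) M2" "M2 \<noteq> {0}"
    and canonical_I: "type_I M1 \<Longrightarrow> type_I M2 \<Longrightarrow>
      canonical_I M1 \<Phi>1 \<and> canonical_I M2 \<Phi>2"
    and canonical_II: "type_II M1 \<Longrightarrow> type_II M2 \<Longrightarrow>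
      canonical_II \<sigma>1 \<theta>1 M1 \<Phi>1 \<G>1 \<and> canonical_II \<sigma>2 \<theta>2 M2 \<Phi>2 \<G>2"
  shows "unitarily_equivalent_on M1 (brownian_shift \<sigma>1 \<theta>1) M2 (brownian_shift \<sigma>2 \<theta>2) \<longleftrightarrow>
    (type_I M1 \<and> type_I M2 \<and> hilbert_dim TYPE('e1) =o hilbert_dim TYPE('e2)) \<or>
    (type_II M1 \<and> type_II M2 \<and> \<theta>1 = \<theta>2 \<and>
      (\<exists>U\<^sub>G U\<^sub>E.
        unitary_between (closed_cspan \<G>1) (closed_cspan \<G>2) U\<^sub>G \<and>
        unitary_between (UNIV :: 'e1 set) (UNIV :: 'e2 set) U\<^sub>E \<and>
        (\<forall>u1\<in>closed_cspan \<G>1. \<forall>u2\<in>closed_cspan \<G>2.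
          U\<^sub>G u1 = u2 \<longrightarrow>
            (\<exists>!x1. G_rel \<sigma>1 \<theta>1 \<Phi>1 u1 x1) \<and> (\<exists>!x2. G_rel \<sigma>2 \<theta>2 \<Phi>2 u2 x2) \<and>
            (\<forall>x1 x2. G_rel \<sigma>1 \<theta>1 \<Phi>1 u1 x1 \<and> G_rel \<sigma>2 \<theta>2 \<Phi>2 u2 x2 \<longrightarrow> U\<^sub>E x1 = x2))))"
proof (cases "type_I M1 \<longleftrightarrow> type_I M2")
  case False
  have "\<not> unitarily_equivalent_on M1 (brownian_shift \<sigma>1 \<theta>1) M2 (brownian_shift \<sigma>2 \<theta>2)"
    using unitarily_equivalent_type_I_iff[OF covariances] M1(1) False
    unfolding invariant_subspace_def by blast
  then show ?thesis using False by (auto simp: type_I_def type_II_def)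
next
  case same: True
  show ?thesis
  proof (cases "type_I M1")
    case True
    then have I: "type_I M1" "type_I M2" and not_II: "\<not> type_II M1"
      using same by (auto simp: type_I_def type_II_def)
    have can: "inner_function \<Phi>1" "M1 = mult_range \<Phi>1 \<times> {0}" "inner_function \<Phi>2" "M2 = mult_range \<Phi>2 \<times> {0}"
      using canonical_I[OF I] by (auto simp: canonical_I_def)
    obtain T1 where T1: "shift_isometry T1" "\<And>f g. mult_rel \<Phi>1 f g \<longleftrightarrow> g = T1 f"
      using inner_function_multiplication[OF can(1)] by blast
    obtain T2 where T2: "shift_isometry T2" "\<And>f g. mult_rel \<Phi>2 f g \<longleftrightarrow> g = T2 f"
      using inner_function_multiplication[OF can(3)] by blast
    show ?thesis
      using type_I_equivalence[OF T1(1) T2(1), of \<sigma>1 \<theta>1 \<sigma>2 \<theta>2] I not_II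
      unfolding can mult_range_eq_range[OF T1(2)] mult_range_eq_range[OF T2(2)] by simp
  next
    case False
    then have II: "type_II M1" "type_II M2" and not_I: "\<not> type_I M1"
      using same by (auto simp: type_I_def type_II_def)
    have can: "canonical_II \<sigma>1 \<theta>1 M1 \<Phi>1 \<G>1" "canonical_II \<sigma>2 \<theta>2 M2 \<Phi>2 \<G>2"
      using canonical_II[OF II] by auto
    have sub: "csubspace M1" "csubspace M2" and inv: "brownian_shift \<sigma>1 \<theta>1 ` M1 \<subseteq> M1"
      using M1 M2 by (auto simp: invariant_subspace_def)
    obtain T1 where m1: "type_II_model \<sigma>1 \<theta>1 T1 (closed_cspan \<G>1) M1" and G1: "\<And>u x. G_rel \<sigma>1 \<theta>1 \<Phi>1 u x
        \<longleftrightarrow> brownian_shift \<sigma>1 \<theta>1 u = cis \<theta>1 *\<^sub>C u + (T1 (hardy_const x), 0)"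
      using canonical_II_model[OF can(1) covariances(1) sub(1)] by blast
    obtain T2 where m2: "type_II_model \<sigma>2 \<theta>2 T2 (closed_cspan \<G>2) M2" and G2: "\<And>u x. G_rel \<sigma>2 \<theta>2 \<Phi>2 u x
        \<longleftrightarrow> brownian_shift \<sigma>2 \<theta>2 u = cis \<theta>2 *\<^sub>C u + (T2 (hardy_const x), 0)"
      using canonical_II_model[OF can(2) covariances(2) sub(2)] by blast
    interpret A: type_II_model \<sigma>1 \<theta>1 T1 "closed_cspan \<G>1" M1 by (rule m1)
    interpret B: type_II_model \<sigma>2 \<theta>2 T2 "closed_cspan \<G>2" M2 by (rule m2)
    have G1: "G_rel \<sigma>1 \<theta>1 \<Phi>1 u x \<longleftrightarrow> x = A.defect u" if "u \<in> closed_cspan \<G>1" for u x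
      unfolding G1 by (rule A.defect_iff[OF that])
    have G2: "G_rel \<sigma>2 \<theta>2 \<Phi>2 u x \<longleftrightarrow> x = B.defect u" if "u \<in> closed_cspan \<G>2" for u x
      unfolding G2 by (rule B.defect_iff[OF that])
    have cond: "(\<forall>u1\<in>closed_cspan \<G>1. \<forall>u2\<in>closed_cspan \<G>2. UG u1 = u2 \<longrightarrow>
          (\<exists>!x1. G_rel \<sigma>1 \<theta>1 \<Phi>1 u1 x1) \<and> (\<exists>!x2. G_rel \<sigma>2 \<theta>2 \<Phi>2 u2 x2) \<and>
          (\<forall>x1 x2. G_rel \<sigma>1 \<theta>1 \<Phi>1 u1 x1 \<and> G_rel \<sigma>2 \<theta>2 \<Phi>2 u2 x2 \<longrightarrow> UE x1 = x2))
        \<longleftrightarrow> (\<forall>u\<in>closed_cspan \<G>1. UE (A.defect u) = B.defect (UG u))"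
      if "unitary_between (closed_cspan \<G>1) (closed_cspan \<G>2) UG" for UG UE
      using unitary_in[OF that] by (auto simp: G1 G2)
    have rhs: "(\<exists>U\<^sub>G U\<^sub>E.
          unitary_between (closed_cspan \<G>1) (closed_cspan \<G>2) U\<^sub>G \<and>
          unitary_between (UNIV :: 'e1 set) (UNIV :: 'e2 set) U\<^sub>E \<and>
          (\<forall>u1\<in>closed_cspan \<G>1. \<forall>u2\<in>closed_cspan \<G>2. U\<^sub>G u1 = u2 \<longrightarrow>
            (\<exists>!x1. G_rel \<sigma>1 \<theta>1 \<Phi>1 u1 x1) \<and> (\<exists>!x2. G_rel \<sigma>2 \<theta>2 \<Phi>2 u2 x2) \<and>
            (\<forall>x1 x2. G_rel \<sigma>1 \<theta>1 \<Phi>1 u1 x1 \<and> G_rel \<sigma>2 \<theta>2 \<Phi>2 u2 x2 \<longrightarrow> U\<^sub>E x1 = x2)))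
        \<longleftrightarrow> (\<exists>UG UE. unitary_between (closed_cspan \<G>1) (closed_cspan \<G>2) UG \<and>
          unitary_between (UNIV :: 'e1 set) (UNIV :: 'e2 set) UE \<and>
          (\<forall>u\<in>closed_cspan \<G>1. UE (A.defect u) = B.defect (UG u)))"
      by (intro ex_cong1 conj_cong refl cond)
    have "unitarily_equivalent_on M1 (brownian_shift \<sigma>1 \<theta>1) M2 (brownian_shift \<sigma>2 \<theta>2)
        \<longleftrightarrow> \<theta>1 = \<theta>2 \<and> (\<exists>UG UE. unitary_between (closed_cspan \<G>1) (closed_cspan \<G>2) UG \<and>
          unitary_between (UNIV :: 'e1 set) (UNIV :: 'e2 set) UE \<and>
          (\<forall>u\<in>closed_cspan \<G>1. UE (A.defect u) = B.defect (UG u)))" (is "?equivalent \<longleftrightarrow> ?compatible")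
    proof
      assume ?equivalent
      then obtain U where U: "unitary_between M1 M2 U"
        "\<And>v. v \<in> M1 \<Longrightarrow> U (brownian_shift \<sigma>1 \<theta>1 v) = brownian_shift \<sigma>2 \<theta>2 (U v)"
        unfolding unitarily_equivalent_on_def by blast
      obtain u0 where "u0 \<in> \<G>1" "u0 \<noteq> 0"
        using can(1) unfolding canonical_II_def by blast
      then have u0: "u0 \<in> closed_cspan \<G>1" "u0 \<noteq> 0"
        using subset_closed_cspan by auto
      obtain W where W: "cis \<theta>1 = cis \<theta>2" "unitary_between (closed_cspan \<G>1) (closed_cspan \<G>2) U"
        "unitary_between UNIV UNIV W" "\<And>u. u \<in> closed_cspan \<G>1 \<Longrightarrow> W (A.defect u) = B.defect (U u)"
        using type_II_equivalence_imp[OF m1 m2 inv U u0] by blast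
      moreover have "\<theta>1 = \<theta>2" by (rule cis_inject[OF W(1) angles])
      ultimately show ?compatible by blast
    next
      assume ?compatible
      then obtain UG UE where \<theta>: "\<theta>1 = \<theta>2"
        and UG: "unitary_between (closed_cspan \<G>1) (closed_cspan \<G>2) UG"
        and UE: "unitary_between (UNIV :: 'e1 set) (UNIV :: 'e2 set) UE"
        and comp: "\<forall>u\<in>closed_cspan \<G>1. UE (A.defect u) = B.defect (UG u)"
        by blast
      show ?equivalent
        using type_II_equivalence_if[OF m1[unfolded \<theta>] m2 UG UE] comp unfolding \<theta> by blast
    qed
    then show ?thesis unfolding rhs using II not_I by blast
  qed
qed

end
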